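(* Let $A\in \mathrm{M}(n,\mathbf{H})$. Then $A$ is invertible if and only if $\mathrm{ddet}\,A\neq 0$. In this case $A^{-1}=(LA)^{-1}=(RA)^{-1}$, where $$(LA)^{-1}=(A^*A)^{-1}A^*=\frac{1}{\mathrm{ddet}\,A}\begin{pmatrix}\mathbb{L}_{11}&\mathbb{L}_{21}&\cdots&\mathbb{L}_{n1}\\ \mathbb{L}_{12}&\mathbb{L}_{22}&\cdots&\mathbb{L}_{n2}\\ \cdots&\cdots&\cdots&\cdots\\ \mathbb{L}_{1n}&\mathbb{L}_{2n}&\cdots&\mathbb{L}_{nn}\end{pmatrix},$$ $$(RA)^{-1}=A^*(AA^* )^{-1}=\frac{1}{\mathrm{ddet}\,A^*}\begin{pmatrix}\mathbb{R}_{11}&\mathbb{R}_{21}&\cdots&\mathbb{R}_{n1}\\ \mathbb{R}_{12}&\mathbb{R}_{22}&\cdots&\mathbb{R}_{n2}\\ \cdots&\cdots&\cdots&\cdots\\ \mathbb{R}_{1n}&\mathbb{R}_{2n}&\cdots&\mathbb{R}_{nn}\end{pmatrix},$$ and the double cofactors are given by $\mathbb{L}_{ij}=\mathrm{cdet}_j\,(A^*A)_{.j}(a^*_{.i})$ and $\mathbb{R}_{ij}=\mathrm{rdet}_i\,(AA^* )_{i.}(a^*_{j.})$ for all $i,j=1,\ldots,n$ (so that $\mathrm{ddet}\,A=\sum_i\mathbb{L}_{ij}a_{ij}$ for every $j$ and $\mathrm{ddet}\,A=\sum_j a_{ij}\mathbb{R}_{ij}$ for every $i$).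
   Context: $\mathbf{H}$ is the skew field of real quaternions with conjugation $q\mapsto\overline q$; $\mathrm{M}(n,\mathbf{H})$ is the ring of $n\times n$ matrices over $\mathbf{H}$; $A^*$ is the conjugate transpose of $A=(a_{ij})$; $A$ is Hermitian if $A=A^*$. Row determinants: for $A=(a_{pq})\in \mathrm{M}(n,\mathbf{H})$ and $i\in\{1,\ldots,n\}$, $$\mathrm{rdet}_i A=\sum_{\sigma\in S_n}(-1)^{n-r}a_{i\,i_{k_1}}a_{i_{k_1}i_{k_1+1}}\cdots a_{i_{k_1+l_1}i}\cdots a_{i_{k_r}i_{k_r+1}}\cdots a_{i_{k_r+l_r}i_{k_r}},$$ where each $\sigma\in S_n$ is written as a product of its $r$ disjoint cycles (fixed points included) $\sigma=(i\,i_{k_1}i_{k_1+1}\ldots i_{k_1+l_1})(i_{k_2}\ldots i_{k_2+l_2})\ldots(i_{k_r}\ldots i_{k_r+l_r})$, each entry of a cycle being mapped to the next; the first cycle starts with $i$, every other cycle starts with its smallest element, and $i_{k_2}<i_{k_3}<\cdots<i_{k_r}$. A fixed point $p$ contributes the factor $a_{pp}$. Column determinants: for $j\in\{1,\ldots,n\}$, $$\mathrm{cdet}_j A=\sum_{\tau\in S_n}(-1)^{n-r}a_{j_{k_r}j_{k_r+l_r}}\cdots a_{j_{k_r+1}j_{k_r}}\cdots a_{j\,j_{k_1+l_1}}\cdots a_{j_{k_1+1}j_{k_1}}a_{j_{k_1}j},$$ where each $\tau\in S_n$ is written as a product of its $r$ disjoint cycles $\tau=(j_{k_r+l_r}\ldots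 j_{k_r+1}j_{k_r})\ldots(j_{k_2+l_2}\ldots j_{k_2+1}j_{k_2})(j_{k_1+l_1}\ldots j_{k_1+1}j_{k_1}j)$; the rightmost cycle ends with $j$, every other cycle has its smallest element in the rightmost position, and $j_{k_2}<j_{k_3}<\cdots<j_{k_r}$. A fixed point $p$ contributes $a_{pp}$. For Hermitian $B\in \mathrm{M}(n,\mathbf{H})$ all the $\mathrm{rdet}_iB$, $\mathrm{cdet}_jB$ coincide and are real; the common value is $\det B$. The double determinant is $\mathrm{ddet}\,A:=\det(A^*A)=\det(AA^* )$. $B_{.j}(v)$ denotes $B$ with its $j$th column replaced by the column $v$, $B_{i.}(v)$ denotes $B$ with its $i$th row replaced by the row $v$; $a^*_{.i}$ and $a^*_{j.}$ are the $i$th column and $j$th row of $A^*$. The left double cofactors $\mathbb{L}_{ij}$ of $A$ are the left coefficients in the expansion $\mathrm{ddet}\,A=\mathrm{cdet}_j(A^*A)=\sum_i\mathbb{L}_{ij}a_{ij}$, and the right double cofactors $\mathbb{R}_{ij}$ are the right coefficients in the expansion $\mathrm{ddet}\,A=\mathrm{rdet}_i(AA^* )=\sum_j a_{ij}\mathbb{R}_{ij}$. *)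

theory Defs
  imports "HOL-Analysis.Analysis" "HOL-Combinatorics.Orbits" "HOL-Combinatorics.Cycles"
begin

section \<open>Real quaternions\<close>

text \<open>\<open>Quat a b c d\<close> stands for \<open>a + b i + c j + d k\<close>.\<close>

datatype quat = Quat (qre: real) (qi: real) (qj: real) (qk: real)

lemma quat_eq_iff:
  "x = y \<longleftrightarrow> qre x = qre y \<and> qi x = qi y \<and> qj x = qj y \<and> qk x = qk y"
  by (cases x; cases y) simp

instantiation quat :: real_algebra_1
begin

definition "0 = Quat 0 0 0 0"
definition "1 = Quat 1 0 0 0"
definition "x + y = Quat (qre x + qre y) (qi x + qi y) (qj x + qj y) (qk x + qk y)"
definition "- x = Quat (- qre x) (- qi x) (- qj x) (- qk x)"
definition "x - y = Quat (qre x - qre y) (qi x - qi y) (qj x - qj y) (qk x - qk y)"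
definition "x * y = Quat
  (qre x * qre y - qi x * qi y - qj x * qj y - qk x * qk y)
  (qre x * qi y + qi x * qre y + qj x * qk y - qk x * qj y)
  (qre x * qj y - qi x * qk y + qj x * qre y + qk x * qi y)
  (qre x * qk y + qi x * qj y - qj x * qi y + qk x * qre y)"
definition "r *\<^sub>R x = Quat (r * qre x) (r * qi x) (r * qj x) (r * qk x)"

instance
  by standard
    (simp_all add: quat_eq_iff zero_quat_def one_quat_def plus_quat_def uminus_quat_def
      minus_quat_def times_quat_def scaleR_quat_def algebra_simps)

end

definition qcnj :: "quat \<Rightarrow> quat" where
  "qcnj x = Quat (qre x) (- qi x) (- qj x) (- qk x)"

definition qnorm2 :: "quat \<Rightarrow> real" where
  "qnorm2 x = (qre x)\<^sup>2 + (qi x)\<^sup>2 + (qj x)\<^sup>2 + (qk x)\<^sup>2"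

lemma qnorm2_eq_0_iff: "qnorm2 x = 0 \<longleftrightarrow> x = 0"
  by (simp add: qnorm2_def add_nonneg_eq_0_iff quat_eq_iff zero_quat_def)

lemma qcnj_mult_self: "qcnj x * x = qnorm2 x *\<^sub>R 1" "x * qcnj x = qnorm2 x *\<^sub>R 1"
  by (simp_all add: quat_eq_iff qcnj_def qnorm2_def times_quat_def scaleR_quat_def one_quat_def
      power2_eq_square)

instantiation quat :: real_div_algebra
begin

definition "inverse x = inverse (qnorm2 x) *\<^sub>R qcnj x"
definition "x div y = x * inverse y" for x y :: quat

instance
proof
  fix x :: quat
  assume "x \<noteq> 0"
  then have nz: "qnorm2 x \<noteq> 0"
    by (simp add: qnorm2_eq_0_iff)
  show "inverse x * x = 1"
    using nz by (simp add: inverse_quat_def qcnj_mult_self)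
  show "x * inverse x = 1"
    using nz by (simp add: inverse_quat_def qcnj_mult_self)
next
  fix x y :: quat
  show "x div y = x * inverse y"
    by (simp add: divide_quat_def)
next
  show "inverse 0 = (0 :: quat)"
    by (simp add: inverse_quat_def qcnj_def quat_eq_iff zero_quat_def scaleR_quat_def)
qed

end

section \<open>Row and column determinants\<close>

text \<open>
  Square quaternionic matrices are indexed by a finite linearly ordered type, which
  plays the role of \<open>{1, \<dots>, n}\<close>; the order is needed to normalise cycle decompositions.
  For a permutation \<open>\<sigma>\<close>, \<open>support \<sigma> p\<close> is the list \<open>[p, \<sigma> p, \<sigma> (\<sigma> p), \<dots>]\<close> running once through
  the cycle of \<open>p\<close>, and \<open>orbit \<sigma> p\<close> is the set of its entries.
\<close>

type_synonym 'n qmat = "((quat, 'n) vec, 'n) vec"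

definition ctransp :: "'n::finite qmat \<Rightarrow> 'n qmat" where
  "ctransp A = (\<chi> i j. qcnj (A $ j $ i))"

definition replace_col :: "'n::finite \<Rightarrow> quat ^ 'n \<Rightarrow> 'n qmat \<Rightarrow> 'n qmat" where
  "replace_col j v B = (\<chi> p q. if q = j then v $ p else B $ p $ q)"

definition replace_row :: "'n::finite \<Rightarrow> quat ^ 'n \<Rightarrow> 'n qmat \<Rightarrow> 'n qmat" where
  "replace_row i v B = (\<chi> p q. if p = i then v $ q else B $ p $ q)"

definition other_cycle_starts ::
    "'n::{finite,linorder} \<Rightarrow> ('n \<Rightarrow> 'n) \<Rightarrow> 'n list" where
  "other_cycle_starts i \<sigma> =
     sorted_list_of_set {m. m \<notin> orbit \<sigma> i \<and> (\<forall>q\<in>orbit \<sigma> m. m \<le> q)}"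

definition cycle_sign :: "('n::finite \<Rightarrow> 'n) \<Rightarrow> quat" where
  "cycle_sign \<sigma> = (-1) ^ (CARD('n) - card (range (orbit \<sigma>)))"

text \<open>
  \<open>cycle_factors A \<sigma> p\<close> lists \<open>a\<^bsub>p,\<sigma>(p)\<^esub>, a\<^bsub>\<sigma>(p),\<sigma>(\<sigma>(p))\<^esub>, \<dots>\<close> up to the factor whose second index
  is \<open>p\<close>. This serves both kinds of determinants: in the column determinant a cycle
  \<open>(p\<^sub>l \<dots> p\<^sub>2 p\<^sub>1 p)\<close> is written with its distinguished element \<open>p\<close> last, so that \<open>p\<close> is mapped to
  \<open>p\<^sub>l\<close> and \<open>p\<^sub>1\<close> to \<open>p\<close>; its contribution, from the entry at \<open>(p, p\<^sub>l)\<close> to the entry at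
  \<open>(p\<^sub>1, p)\<close>, is again the product of this list. Only the order of the cycles is reversed.
\<close>

definition cycle_factors ::
    "'n::finite qmat \<Rightarrow> ('n \<Rightarrow> 'n) \<Rightarrow> 'n \<Rightarrow> quat list" where
  "cycle_factors A \<sigma> p = map (\<lambda>q. A $ q $ \<sigma> q) (support \<sigma> p)"

definition row_factors ::
    "'n::{finite,linorder} \<Rightarrow> ('n \<Rightarrow> 'n) \<Rightarrow> 'n qmat \<Rightarrow> quat list" where
  "row_factors i \<sigma> A = concat (map (cycle_factors A \<sigma>) (i # other_cycle_starts i \<sigma>))"

definition col_factors ::
    "'n::{finite,linorder} \<Rightarrow> ('n \<Rightarrow> 'n) \<Rightarrow> 'n qmat \<Rightarrow> quat list" where
  "col_factors j \<tau> A = concat (map (cycle_factors A \<tau>) (rev (j # other_cycle_starts j \<tau>)))"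

definition rdet :: "'n::{finite,linorder} \<Rightarrow> 'n qmat \<Rightarrow> quat" where
  "rdet i A = (\<Sum>\<sigma> | \<sigma> permutes UNIV. cycle_sign \<sigma> * prod_list (row_factors i \<sigma> A))"

definition cdet :: "'n::{finite,linorder} \<Rightarrow> 'n qmat \<Rightarrow> quat" where
  "cdet j A = (\<Sum>\<tau> | \<tau> permutes UNIV. cycle_sign \<tau> * prod_list (col_factors j \<tau> A))"

text \<open>
  Meaningful only for Hermitian \<open>B\<close>, where the common value exists and is real.
\<close>

definition hdet :: "'n::{finite,linorder} qmat \<Rightarrow> real" where
  "hdet B = (THE d. (\<forall>i. rdet i B = of_real d) \<and> (\<forall>j. cdet j B = of_real d))"

definition ddet :: "'n::{finite,linorder} qmat \<Rightarrow> real" where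
  "ddet A = hdet (ctransp A ** A)"

section \<open>Double cofactors\<close>

text \<open>
  Every monomial of \<open>cdet j B\<close> ends with a factor \<open>b\<^bsub>qj\<^esub>\<close>, where \<open>\<tau> q = j\<close>. Collecting the monomials
  that end with \<open>b\<^bsub>qj\<^esub>\<close> gives the left coefficient of \<open>b\<^bsub>qj\<^esub>\<close>. Symmetrically, every monomial
  of \<open>rdet i B\<close> begins with a factor \<open>b\<^bsub>iq\<^esub>\<close>, where \<open>\<sigma> i = q\<close>.
\<close>

definition left_cofactor :: "'n::{finite,linorder} qmat \<Rightarrow> 'n \<Rightarrow> 'n \<Rightarrow> quat" where
  "left_cofactor B q j =
     (\<Sum>\<tau> | \<tau> permutes UNIV \<and> \<tau> q = j. cycle_sign \<tau> * prod_list (butlast (col_factors j \<tau> B)))"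

definition right_cofactor :: "'n::{finite,linorder} qmat \<Rightarrow> 'n \<Rightarrow> 'n \<Rightarrow> quat" where
  "right_cofactor B i q =
     (\<Sum>\<sigma> | \<sigma> permutes UNIV \<and> \<sigma> i = q. cycle_sign \<sigma> * prod_list (tl (row_factors i \<sigma> B)))"

text \<open>
  For \<open>B = A\<^sup>* A\<close> the factor \<open>b\<^bsub>qj\<^esub>\<close> is \<open>\<Sum>\<^sub>i a\<^sup>*\<^bsub>qi\<^esub> a\<^bsub>ij\<^esub>\<close>; inserting this at the right end of the
  expansion of \<open>cdet j B\<close> and collecting the left coefficients of \<open>a\<^bsub>ij\<^esub>\<close> yields the left double
  cofactors. The right ones arise from \<open>b\<^bsub>iq\<^esub> = \<Sum>\<^sub>j a\<^bsub>ij\<^esub> a\<^sup>*\<^bsub>jq\<^esub>\<close> for \<open>B = A A\<^sup>*\<close>.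
\<close>

definition left_double_cofactor ::
    "'n::{finite,linorder} qmat \<Rightarrow> 'n \<Rightarrow> 'n \<Rightarrow> quat" where
  "left_double_cofactor A i j =
     (\<Sum>q\<in>UNIV. left_cofactor (ctransp A ** A) q j * ctransp A $ q $ i)"

definition right_double_cofactor ::
    "'n::{finite,linorder} qmat \<Rightarrow> 'n \<Rightarrow> 'n \<Rightarrow> quat" where
  "right_double_cofactor A i j =
     (\<Sum>q\<in>UNIV. ctransp A $ j $ q * right_cofactor (A ** ctransp A) i q)"

end

theory Submission
  imports Defs
begin

text \<open>
  The idea is to reduce everything to a real number, the Moore determinant
  \<open>\<Sum>\<sigma>. sgn \<sigma> * (\<Prod>c. Re (b\<^sub>c))\<close>, where \<open>c\<close> runs through the cycles of \<open>\<sigma>\<close> and \<open>b\<^sub>c\<close> is the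
  product of the entries of \<open>B\<close> along \<open>c\<close>. Only real parts enter, so neither the starting points
  nor the order of the cycles matter.

  If \<open>B\<close> is Hermitian, reversing a cycle conjugates its product \<open>b\<^sub>c\<close> and changes nothing else.
  Summing over a cycle and its reversal, one may therefore replace each \<open>b\<^sub>c\<close> by its real part,
  and every \<open>rdet i B\<close> equals the Moore determinant (\<open>rdet_hermitian\<close>). Column determinants
  follow by conjugation, because \<open>cdet j B\<close> is the conjugate of \<open>rdet j (B\<^sup>*)\<close>
  (\<open>cdet_conv_rdet\<close>). If instead row \<open>i\<close> of \<open>B\<close> is overwritten by row \<open>k\<close>, then the row
  determinant vanishes (\<open>rdet_repeated_row\<close>): composing \<open>\<sigma>\<close> with the transposition of \<open>i\<close> and
  \<open>k\<close> merges the cycles of \<open>i\<close> and \<open>k\<close>, flips the sign and multiplies the two cycle products;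
  the terms then cancel up to the imaginary part of the product over the \<open>k\<close>-cycle, which dies
  under the reversal of that cycle. Both facts together say that the matrix of right cofactors
  is an adjugate: its product with \<open>B\<close> is \<open>det B\<close> times the identity (\<open>mult_right_adj\<close>). For
  \<open>B = A\<^sup>* A\<close> and \<open>B = A A\<^sup>*\<close> this gives the two formulas for the inverse as soon as the double
  determinant does not vanish.

  It remains to show that \<open>det (A\<^sup>* A) = det (A A\<^sup>*)\<close> and that an invertible Hermitian matrix
  has nonzero determinant. The function \<open>p(t) = det (B + t)\<close> is a monic real polynomial, and
  \<open>p'(t)\<close> is the real part of the trace of the adjugate of \<open>B + t\<close> (\<open>poly_pderiv_moore_poly\<close>).
  Since the real part of a trace does not change under \<open>X Y \<mapsto> Y X\<close>, adjugates can be compared by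
  traces: the Wronskian of \<open>det (A\<^sup>* A + t)\<close> and \<open>det (A A\<^sup>* + t)\<close> vanishes, so these monic
  polynomials coincide (\<open>moore_poly_ctransp_mult_commute\<close>). Likewise, if \<open>D\<close> is the inverse of
  \<open>B\<close>, the Wronskian of \<open>det (B + t)\<close> and \<open>t\<^sup>n det (D + 1 / t)\<close> vanishes, so the two are
  proportional; the second has value 1 at \<open>t = 0\<close>, hence \<open>det B \<noteq> 0\<close> (\<open>moore_det_nonzero\<close>).
\<close>

section \<open>Cycles of a permutation as lists\<close>

lemma permutes_UNIV_imp_permutation:
  fixes \<sigma> :: "'n::finite \<Rightarrow> 'n"
  shows "\<sigma> permutes UNIV \<Longrightarrow> permutation \<sigma>"
  unfolding permutation_permutes by (rule exI[of _ UNIV]) simp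

lemma self_in_orbit:
  fixes \<sigma> :: "'n::finite \<Rightarrow> 'n"
  shows "\<sigma> permutes UNIV \<Longrightarrow> x \<in> orbit \<sigma> x"
  by (simp add: permutation_self_in_orbit permutes_UNIV_imp_permutation)

lemma orbit_eq:
  fixes \<sigma> :: "'n::finite \<Rightarrow> 'n"
  assumes "\<sigma> permutes UNIV" "y \<in> orbit \<sigma> x"
  shows "orbit \<sigma> y = orbit \<sigma> x"
  using assms by (meson orbit_swap orbit_trans self_in_orbit subsetI subset_antisym)

lemma in_orbit_commute:
  fixes \<sigma> :: "'n::finite \<Rightarrow> 'n"
  assumes "\<sigma> permutes UNIV"
  shows "y \<in> orbit \<sigma> x \<longleftrightarrow> x \<in> orbit \<sigma> y"
  using assms by (metis orbit_eq self_in_orbit)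

lemma step_in_orbit_iff:
  fixes \<sigma> :: "'n::finite \<Rightarrow> 'n"
  assumes "\<sigma> permutes UNIV"
  shows "\<sigma> y \<in> orbit \<sigma> x \<longleftrightarrow> y \<in> orbit \<sigma> x"
  using assms permutation_orbit_step[OF permutes_UNIV_imp_permutation[OF assms], of y]
  by (simp add: in_orbit_commute[of _ _ x])

text \<open>
  Cycles are handled as lists: the last condition says that \<open>\<sigma>\<close> sends each entry to the next one
  and the last to the first. In this form rotating, reversing, merging and splitting cycles
  become identities about \<open>map\<close>, \<open>rev\<close> and \<open>append\<close>.
\<close>

definition is_cycle :: "('a \<Rightarrow> 'a) \<Rightarrow> 'a list \<Rightarrow> bool" where
  "is_cycle \<sigma> xs \<longleftrightarrow> xs \<noteq> [] \<and> distinct xs \<and> map \<sigma> xs = rotate1 xs"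

text \<open>
  A list that is rotated by \<open>\<sigma>\<close> is the cycle of its head, so that the determinants need never be
  unfolded down to iterates of \<open>\<sigma>\<close>.
\<close>

lemma
  assumes "is_cycle \<sigma> xs"
  shows support_is_cycle: "support \<sigma> (hd xs) = xs"
    and orbit_is_cycle: "orbit \<sigma> (hd xs) = set xs"
proof -
  let ?n = "length xs"
  have ne: "xs \<noteq> []" and d: "distinct xs" and rot: "map \<sigma> xs = rotate1 xs"
    using assms by (auto simp: is_cycle_def)
  then have n: "0 < ?n"
    by simp
  have nxt: "\<sigma> (xs ! j) = xs ! (Suc j mod ?n)" if "j < ?n" for j
    using that by (metis nth_map nth_rotate1 rot)
  have pow: "(\<sigma> ^^ k) (hd xs) = xs ! (k mod ?n)" for k
  proof (induction k)
    case 0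
    then show ?case using ne by (simp add: hd_conv_nth)
  next
    case (Suc k)
    then show ?case using n by (simp add: nxt mod_Suc_eq)
  qed
  have full: "(\<sigma> ^^ ?n) (hd xs) = hd xs"
    unfolding pow using ne by (simp add: hd_conv_nth)
  have lp: "least_power \<sigma> (hd xs) = ?n"
    unfolding least_power_def
  proof (rule Least_equality)
    show "(\<sigma> ^^ ?n) (hd xs) = hd xs \<and> 0 < ?n"
      using full n by simp
  next
    fix m assume m: "(\<sigma> ^^ m) (hd xs) = hd xs \<and> 0 < m"
    then have "xs ! (m mod ?n) = xs ! 0"
      unfolding pow using ne by (simp add: hd_conv_nth)
    then have "m mod ?n = 0"
      using d n by (simp add: nth_eq_iff_index_eq)
    then show "?n \<le> m"
      using m by (meson dvd_imp_le mod_0_imp_dvd)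
  qed
  show "support \<sigma> (hd xs) = xs"
    unfolding lp by (rule nth_equalityI) (simp_all add: pow)
  show "orbit \<sigma> (hd xs) = set xs"
    unfolding orbit_altdef_bounded[OF full n] by (auto simp: pow set_conv_nth) (metis mod_less)
qed

lemma is_cycle_exists:
  fixes \<sigma> :: "'n::finite \<Rightarrow> 'n"
  assumes "\<sigma> permutes UNIV"
  obtains xs where "is_cycle \<sigma> (p # xs)"
proof -
  let ?n = "least_power \<sigma> p"
  have perm: "permutation \<sigma>"
    using assms by (rule permutes_UNIV_imp_permutation)
  note lp = least_power_of_permutation[OF perm, of p]
  have "map \<sigma> (support \<sigma> p) = rotate1 (support \<sigma> p)"
  proof (rule nth_equalityI)
    fix j assume "j < length (map \<sigma> (support \<sigma> p))"
    then have j: "j < ?n" by simp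
    show "map \<sigma> (support \<sigma> p) ! j = rotate1 (support \<sigma> p) ! j"
    proof (cases "Suc j = ?n")
      case True
      then have "\<sigma> ((\<sigma> ^^ j) p) = p"
        using lp(1) by (metis comp_apply funpow.simps(2))
      with True j show ?thesis
        by (simp add: nth_rotate1)
    next
      case False
      with j show ?thesis
        by (simp add: nth_rotate1)
    qed
  qed simp
  moreover have "distinct (support \<sigma> p)"
    by (rule cycle_of_permutation[OF perm])
  moreover obtain xs where "support \<sigma> p = p # xs"
    using lp(2) by (simp add: upt_conv_Cons)
  ultimately have "is_cycle \<sigma> (p # xs)"
    by (simp add: is_cycle_def)
  then show ?thesis ..
qed

lemma is_cycle_cong:
  assumes "is_cycle \<sigma> xs" "\<And>y. y \<in> set xs \<Longrightarrow> \<tau> y = \<sigma> y"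
  shows "is_cycle \<tau> xs"
proof -
  have "map \<tau> xs = map \<sigma> xs"
    using assms(2) by simp
  then show ?thesis using assms(1) unfolding is_cycle_def by metis
qed

lemma is_cycle_rotate: "is_cycle \<sigma> (x # xs) \<Longrightarrow> is_cycle \<sigma> (xs @ [x])"
  unfolding is_cycle_def by (cases xs) auto

definition cycle_prod :: "'n::finite qmat \<Rightarrow> ('n \<Rightarrow> 'n) \<Rightarrow> 'n \<Rightarrow> quat" where
  "cycle_prod B \<sigma> p = prod_list (cycle_factors B \<sigma> p)"

lemma cycle_factors_is_cycle:
  "is_cycle \<sigma> (p # xs) \<Longrightarrow> cycle_factors B \<sigma> p = map (\<lambda>q. B $ q $ \<sigma> q) (p # xs)"
  unfolding cycle_factors_def using support_is_cycle by force

lemma cycle_prod_is_cycle: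
  "is_cycle \<sigma> (p # xs) \<Longrightarrow> cycle_prod B \<sigma> p = (\<Prod>q\<leftarrow>p # xs. B $ q $ \<sigma> q)"
  by (simp only: cycle_prod_def cycle_factors_is_cycle)

lemma orbit_is_cycle_Cons: "is_cycle \<sigma> (p # xs) \<Longrightarrow> orbit \<sigma> p = set (p # xs)"
  using orbit_is_cycle by force

text \<open>
  A cycle and its entries depend only on the values of the permutation and of the matrix along
  that cycle. This is what keeps the other cycles untouched when one of them is modified.
\<close>

lemma cycle_cong:
  fixes \<sigma> :: "'n::finite \<Rightarrow> 'n"
  assumes \<sigma>: "\<sigma> permutes UNIV"
    and eq: "\<And>y. y \<in> orbit \<sigma> p \<Longrightarrow> \<tau> y = \<sigma> y"
    and B: "\<And>y. y \<in> orbit \<sigma> p \<Longrightarrow> B' $ y $ \<sigma> y = B $ y $ \<sigma> y"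
  shows "orbit \<tau> p = orbit \<sigma> p" "cycle_factors B' \<tau> p = cycle_factors B \<sigma> p"
    "cycle_prod B' \<tau> p = cycle_prod B \<sigma> p"
proof -
  obtain xs where xs: "is_cycle \<sigma> (p # xs)"
    using \<sigma> by (rule is_cycle_exists)
  note o = orbit_is_cycle_Cons[OF xs]
  have t: "is_cycle \<tau> (p # xs)"
    by (rule is_cycle_cong[OF xs]) (use eq o in auto)
  show "orbit \<tau> p = orbit \<sigma> p"
    using o orbit_is_cycle_Cons[OF t] by simp
  show "cycle_factors B' \<tau> p = cycle_factors B \<sigma> p"
    unfolding cycle_factors_is_cycle[OF t] cycle_factors_is_cycle[OF xs]
    using B eq o by (intro map_cong) auto
  then show "cycle_prod B' \<tau> p = cycle_prod B \<sigma> p"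
    by (simp add: cycle_prod_def)
qed

section \<open>Conjugation and real part of quaternions\<close>

lemmas quat_arith = quat_eq_iff qcnj_def zero_quat_def one_quat_def plus_quat_def
  uminus_quat_def minus_quat_def times_quat_def scaleR_quat_def

lemma qcnj_simps [simp]:
  "qcnj 0 = 0" "qcnj 1 = 1" "qcnj (qcnj x) = x" "qcnj (- x) = - qcnj x"
  "qcnj (x + y) = qcnj x + qcnj y" "qcnj (x * y) = qcnj y * qcnj x"
  "qcnj (of_real r) = of_real r" "qcnj (r *\<^sub>R x) = r *\<^sub>R qcnj x"
  by (simp_all add: quat_arith of_real_def)

lemma qcnj_sum: "qcnj (sum f S) = (\<Sum>x\<in>S. qcnj (f x))"
  by (induction S rule: infinite_finite_induct) simp_all

lemma qcnj_prod_list: "qcnj (prod_list xs) = prod_list (map qcnj (rev xs))"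
  by (induction xs) simp_all

lemma qre_simps [simp]:
  "qre 0 = 0" "qre 1 = 1" "qre (x + y) = qre x + qre y" "qre (x - y) = qre x - qre y" "qre (- x) = - qre x"
  "qre (r *\<^sub>R x) = r * qre x" "qre (of_real r) = r" "qre (qcnj x) = qre x"
  by (simp_all add: quat_arith of_real_def)

lemma qre_sum: "qre (sum f S) = (\<Sum>x\<in>S. qre (f x))"
  by (induction S rule: infinite_finite_induct) simp_all

lemma qre_mult_commute: "qre (x * y) = qre (y * x)"
  by (simp add: quat_arith)

lemma add_qcnj: "x + qcnj x = of_real (2 * qre x)"
  by (simp add: quat_arith of_real_def)

lemma of_real_mult_commute: "of_real r * x = x * (of_real r :: 'a::real_algebra_1)"
  by (simp add: of_real_def)

text \<open>
  Each summand is averaged with its partner under the involution: the outer factors agree and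
  the middle ones are conjugate, so their mean is a real part.
\<close>

lemma sum_involution_qre:
  assumes "\<And>x. x \<in> D \<Longrightarrow> f x \<in> D" "\<And>x. x \<in> D \<Longrightarrow> f (f x) = x"
    "\<And>x. x \<in> D \<Longrightarrow> a (f x) = a x" "\<And>x. x \<in> D \<Longrightarrow> b (f x) = b x"
    "\<And>x. x \<in> D \<Longrightarrow> g (f x) = qcnj (g x)"
  shows "(\<Sum>x\<in>D. a x * g x * b x) = (\<Sum>x\<in>D. a x * of_real (qre (g x)) * b x)"
proof -
  let ?S = "\<Sum>x\<in>D. a x * g x * b x"
  have "?S = (\<Sum>x\<in>D. a x * qcnj (g x) * b x)"
    by (rule sum.reindex_bij_witness[of _ f f]) (auto simp: assms)
  then have "2 *\<^sub>R ?S = (\<Sum>x\<in>D. a x * (g x + qcnj (g x)) * b x)"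
    by (simp add: scaleR_2 algebra_simps sum.distrib)
  also have "\<dots> = 2 *\<^sub>R (\<Sum>x\<in>D. a x * of_real (qre (g x)) * b x)"
    unfolding add_qcnj by (simp add: scaleR_sum_right of_real_def)
  finally show ?thesis by simp
qed

section \<open>Reversing one cycle of a permutation\<close>

definition rev_cycle :: "'a \<Rightarrow> ('a \<Rightarrow> 'a) \<Rightarrow> 'a \<Rightarrow> 'a" where
  "rev_cycle x \<sigma> = (\<lambda>y. if y \<in> orbit \<sigma> x then inv \<sigma> y else \<sigma> y)"

lemma is_cycle_inv:
  assumes "is_cycle \<sigma> (p # xs)" "inj \<sigma>"
  shows "is_cycle (inv \<sigma>) (p # rev xs)"
proof -
  have rot: "map \<sigma> (p # xs) = xs @ [p]" and d: "distinct (p # xs)"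
    using assms(1) by (auto simp: is_cycle_def)
  have "map (inv \<sigma>) (xs @ [p]) = p # xs"
    unfolding rot[symmetric] using assms(2) by (simp add: map_idI)
  then have "rev (map (inv \<sigma>) (xs @ [p])) = rev (p # xs)"
    by simp
  then have "map (inv \<sigma>) (p # rev xs) = rotate1 (p # rev xs)"
    by (simp add: rev_map)
  then show ?thesis
    using d by (simp add: is_cycle_def)
qed

lemma rev_map_is_cycle:
  assumes "is_cycle \<sigma> (p # xs)"
  shows "p # rev xs = rev (map \<sigma> (p # xs))"
  using assms by (simp add: is_cycle_def)

text \<open>
  Traversing a cycle backwards reverses the order of its factors. If the factors are conjugated
  at the same time, this is exactly conjugation of the product, since conjugation reverses
  products. The matrix \<open>B'\<close> is either \<open>B\<close> itself, for \<open>B\<close> Hermitian along the cycle, or the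
  conjugate transpose of \<open>B\<close>.
\<close>

lemma cycle_prod_inverse:
  assumes c: "is_cycle \<sigma> (p # xs)" and inj: "inj \<sigma>"
    and eq: "\<And>y. y \<in> set (p # xs) \<Longrightarrow> \<tau> y = inv \<sigma> y"
    and adj: "\<And>y. y \<in> set (p # xs) \<Longrightarrow> B' $ \<sigma> y $ y = qcnj (B $ y $ \<sigma> y)"
  shows "cycle_factors B' \<tau> p = rev (map qcnj (cycle_factors B \<sigma> p))"
    "cycle_prod B' \<tau> p = qcnj (cycle_prod B \<sigma> p)"
proof -
  have t: "is_cycle \<tau> (p # rev xs)"
    by (rule is_cycle_cong[OF is_cycle_inv[OF c inj]]) (use eq in auto)
  have *: "\<sigma> y \<in> set (p # xs)" if "y \<in> set (p # xs)" for y
  proof -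
    have "set (map \<sigma> (p # xs)) = set (p # xs)"
      using c by (simp add: is_cycle_def del: list.map)
    then show ?thesis using that by auto
  qed
  have "cycle_factors B' \<tau> p = map (\<lambda>q. B' $ q $ \<tau> q) (rev (map \<sigma> (p # xs)))"
    unfolding cycle_factors_is_cycle[OF t] rev_map_is_cycle[OF c] ..
  also have "\<dots> = rev (map (\<lambda>y. B' $ \<sigma> y $ \<tau> (\<sigma> y)) (p # xs))"
    by (simp add: rev_map)
  also have "map (\<lambda>y. B' $ \<sigma> y $ \<tau> (\<sigma> y)) (p # xs) = map (\<lambda>y. qcnj (B $ y $ \<sigma> y)) (p # xs)"
  proof (rule map_cong[OF refl])
    fix y assume y: "y \<in> set (p # xs)"
    then show "B' $ \<sigma> y $ \<tau> (\<sigma> y) = qcnj (B $ y $ \<sigma> y)"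
      using adj[OF y] eq[OF *[OF y]] inj by simp
  qed
  finally show f: "cycle_factors B' \<tau> p = rev (map qcnj (cycle_factors B \<sigma> p))"
    unfolding cycle_factors_is_cycle[OF c] by (simp add: comp_def)
  then show "cycle_prod B' \<tau> p = qcnj (cycle_prod B \<sigma> p)"
    by (simp add: cycle_prod_def qcnj_prod_list rev_map)
qed

lemma rev_cycle_permutes:
  fixes \<sigma> :: "'n::finite \<Rightarrow> 'n"
  assumes \<sigma>: "\<sigma> permutes UNIV"
  shows "rev_cycle x \<sigma> permutes UNIV"
proof -
  have "y \<in> range (rev_cycle x \<sigma>)" for y
  proof (cases "y \<in> orbit \<sigma> x")
    case True
    then have "rev_cycle x \<sigma> (\<sigma> y) = y"
      using \<sigma> by (simp add: rev_cycle_def step_in_orbit_iff permutes_inverses)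
    then show ?thesis by (metis rangeI)
  next
    case False
    then have "inv \<sigma> y \<notin> orbit \<sigma> x"
      using step_in_orbit_iff[OF \<sigma>, of "inv \<sigma> y" x] \<sigma> by (simp add: permutes_inverses)
    then have "rev_cycle x \<sigma> (inv \<sigma> y) = y"
      using \<sigma> by (simp add: rev_cycle_def permutes_inverses)
    then show ?thesis by (metis rangeI)
  qed
  then have "surj (rev_cycle x \<sigma>)" by blast
  then have "bij (rev_cycle x \<sigma>)"
    by (simp add: bij_def finite_UNIV_surj_inj)
  then show ?thesis by (rule bij_imp_permutes) simp
qed

text \<open>
  Reversing a cycle preserves the partition into orbits, hence the sign and the chosen starting
  points, and its only effect on the cycle products is to conjugate the one of the reversed
  cycle.
\<close>

lemma
  fixes \<sigma> :: "'n::finite \<Rightarrow> 'n"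
  assumes \<sigma>: "\<sigma> permutes UNIV"
  shows orbit_rev_cycle: "orbit (rev_cycle x \<sigma>) m = orbit \<sigma> m"
    and cycle_prod_rev_cycle_other:
      "m \<notin> orbit \<sigma> x \<Longrightarrow> cycle_prod B (rev_cycle x \<sigma>) m = cycle_prod B \<sigma> m"
    and cycle_prod_rev_cycle:
      "\<lbrakk>\<And>y z. y \<in> orbit \<sigma> x \<Longrightarrow> z \<in> orbit \<sigma> x \<Longrightarrow> B $ z $ y = qcnj (B $ y $ z); m \<in> orbit \<sigma> x\<rbrakk> \<Longrightarrow>
        cycle_prod B (rev_cycle x \<sigma>) m = qcnj (cycle_prod B \<sigma> m)"
proof -
  have agree: "rev_cycle x \<sigma> y = \<sigma> y" if "m \<notin> orbit \<sigma> x" "y \<in> orbit \<sigma> m" for y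
    using that \<sigma> by (metis in_orbit_commute orbit_eq rev_cycle_def)
  obtain xs where xs: "is_cycle \<sigma> (m # xs)"
    using \<sigma> by (rule is_cycle_exists)
  note o = orbit_is_cycle_Cons[OF xs]
  have inj: "inj \<sigma>" using \<sigma> by (rule permutes_inj)
  have eq: "rev_cycle x \<sigma> y = inv \<sigma> y" if "m \<in> orbit \<sigma> x" "y \<in> set (m # xs)" for y
    using that \<sigma> o by (metis orbit_eq rev_cycle_def)
  show "orbit (rev_cycle x \<sigma>) m = orbit \<sigma> m"
  proof (cases "m \<in> orbit \<sigma> x")
    case True
    have "is_cycle (rev_cycle x \<sigma>) (m # rev xs)"
      by (rule is_cycle_cong[OF is_cycle_inv[OF xs inj]]) (use eq True in auto)
    from orbit_is_cycle_Cons[OF this] show ?thesis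
      using o by simp
  next
    case False
    show ?thesis by (rule cycle_cong(1)[OF \<sigma> agree[OF False], where B = 0 and B' = 0]) simp_all
  qed
  show "cycle_prod B (rev_cycle x \<sigma>) m = cycle_prod B \<sigma> m" if "m \<notin> orbit \<sigma> x"
    by (rule cycle_cong(3)[OF \<sigma> agree[OF that] refl])
  show "cycle_prod B (rev_cycle x \<sigma>) m = qcnj (cycle_prod B \<sigma> m)"
    if B: "\<And>y z. y \<in> orbit \<sigma> x \<Longrightarrow> z \<in> orbit \<sigma> x \<Longrightarrow> B $ z $ y = qcnj (B $ y $ z)"
      and m: "m \<in> orbit \<sigma> x"
  proof (rule cycle_prod_inverse(2)[OF xs inj eq[OF m]])
    fix y assume "y \<in> set (m # xs)"
    then have "y \<in> orbit \<sigma> x" using o orbit_eq[OF \<sigma> m] by simp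
    then show "B $ \<sigma> y $ y = qcnj (B $ y $ \<sigma> y)"
      using step_in_orbit_iff[OF \<sigma>] by (intro B) simp_all
  qed
qed

lemma rev_cycle_rev_cycle:
  fixes \<sigma> :: "'n::finite \<Rightarrow> 'n"
  assumes \<sigma>: "\<sigma> permutes UNIV"
  shows "rev_cycle x (rev_cycle x \<sigma>) = \<sigma>"
proof
  fix y
  let ?t = "rev_cycle x \<sigma>"
  show "rev_cycle x ?t y = \<sigma> y"
  proof (cases "y \<in> orbit \<sigma> x")
    case True
    have "?t (\<sigma> y) = y"
      using True \<sigma> by (simp add: rev_cycle_def step_in_orbit_iff permutes_inverses)
    then have "inv ?t y = \<sigma> y"
      using permutes_inv_eq[OF rev_cycle_permutes[OF \<sigma>]] by metis
    then show ?thesis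
      using True by (simp add: rev_cycle_def[of x ?t] orbit_rev_cycle[OF \<sigma>])
  next
    case False
    then show ?thesis
      by (simp add: rev_cycle_def[of x ?t] orbit_rev_cycle[OF \<sigma>]) (simp add: rev_cycle_def)
  qed
qed

lemma
  fixes \<sigma> :: "'n::{finite,linorder} \<Rightarrow> 'n"
  assumes "\<And>m. orbit \<tau> m = orbit \<sigma> m"
  shows other_cycle_starts_cong: "other_cycle_starts i \<tau> = other_cycle_starts i \<sigma>"
    and cycle_sign_cong: "cycle_sign \<tau> = cycle_sign \<sigma>"
proof -
  have "orbit \<tau> = orbit \<sigma>" using assms by blast
  then show "other_cycle_starts i \<tau> = other_cycle_starts i \<sigma>" "cycle_sign \<tau> = cycle_sign \<sigma>"
    by (simp_all add: other_cycle_starts_def cycle_sign_def)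
qed

section \<open>Row determinants of Hermitian matrices\<close>

lemma set_other_cycle_starts:
  "set (other_cycle_starts i \<sigma>) = {m. m \<notin> orbit \<sigma> i \<and> (\<forall>q\<in>orbit \<sigma> m. m \<le> q)}"
  by (simp add: other_cycle_starts_def)

lemma distinct_other_cycle_starts: "distinct (other_cycle_starts i \<sigma>)"
  by (simp add: other_cycle_starts_def)

lemma other_cycle_starts_disjoint:
  fixes \<sigma> :: "'n::{finite,linorder} \<Rightarrow> 'n"
  assumes \<sigma>: "\<sigma> permutes UNIV"
    and "x \<in> set (other_cycle_starts i \<sigma>)" "m \<in> set (other_cycle_starts i \<sigma>)" "m \<noteq> x"
  shows "m \<notin> orbit \<sigma> x"
proof
  assume m: "m \<in> orbit \<sigma> x"
  then have "x \<in> orbit \<sigma> m"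
    using in_orbit_commute[OF \<sigma>] by blast
  then have "m \<le> x" "x \<le> m"
    using assms(2,3) m by (auto simp: set_other_cycle_starts)
  then show False using \<open>m \<noteq> x\<close> by simp
qed

lemma prod_list_concat: "prod_list (concat xss) = prod_list (map prod_list xss)"
  for xss :: "'a::monoid_mult list list"
  by (induction xss) simp_all

lemma prod_list_row_factors:
  "prod_list (row_factors i \<sigma> B) =
    cycle_prod B \<sigma> i * prod_list (map (cycle_prod B \<sigma>) (other_cycle_starts i \<sigma>))"
  by (simp add: row_factors_def prod_list_concat cycle_prod_def[abs_def] comp_def)

definition rsign :: "('n::finite \<Rightarrow> 'n) \<Rightarrow> real" where
  "rsign \<sigma> = (-1) ^ (CARD('n) - card (range (orbit \<sigma>)))"

lemma cycle_sign_conv: "cycle_sign \<sigma> = of_real (rsign \<sigma>)"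
  by (simp add: cycle_sign_def rsign_def)

lemma of_real_prod_distinct:
  "distinct L \<Longrightarrow> (\<Prod>m\<leftarrow>L. of_real (f m)) = (of_real (\<Prod>m\<in>set L. f m) :: 'a::real_algebra_1)"
  by (induction L) simp_all

text \<open>
  The permutations in which \<open>x\<close> starts a cycle other than that of \<open>i\<close> are paired by the reversal
  of this cycle, for one \<open>x\<close> at a time; this replaces one cycle product after the other by its
  real part. Only the entries off row and column \<open>i\<close> have to be Hermitian, as the other cycles
  avoid \<open>i\<close>, so that row \<open>i\<close> may be modified freely. The weight \<open>h\<close> stands for the contribution
  of the cycle of \<open>i\<close>.
\<close>

lemma sum_other_cycles_qre:
  fixes B :: "'n::{finite,linorder} qmat" and h :: "('n \<Rightarrow> 'n) \<Rightarrow> quat"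
  assumes B: "\<And>p q. p \<noteq> i \<Longrightarrow> q \<noteq> i \<Longrightarrow> B $ q $ p = qcnj (B $ p $ q)"
    and h: "\<And>\<sigma> x. \<sigma> permutes UNIV \<Longrightarrow> x \<notin> orbit \<sigma> i \<Longrightarrow> h (rev_cycle x \<sigma>) = h \<sigma>"
  shows "(\<Sum>\<sigma> | \<sigma> permutes UNIV. cycle_sign \<sigma> * h \<sigma> *
        prod_list (map (cycle_prod B \<sigma>) (other_cycle_starts i \<sigma>))) =
      (\<Sum>\<sigma> | \<sigma> permutes UNIV. cycle_sign \<sigma> * h \<sigma> *
        of_real (\<Prod>m\<in>set (other_cycle_starts i \<sigma>). qre (cycle_prod B \<sigma> m)))"
proof -
  define w where "w S \<sigma> m = (if m \<in> S then of_real (qre (cycle_prod B \<sigma> m)) else cycle_prod B \<sigma> m)"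
    for S \<sigma> m
  define F where "F S \<sigma> = cycle_sign \<sigma> * h \<sigma> * prod_list (map (w S \<sigma>) (other_cycle_starts i \<sigma>))"
    for S \<sigma>
  have "sum (F S) {\<sigma>. \<sigma> permutes UNIV} = sum (F {}) {\<sigma>. \<sigma> permutes UNIV}" if "finite S" for S
    using that
  proof (induction S rule: finite_induct)
    case (insert x S)
    let ?D = "{\<sigma>. \<sigma> permutes UNIV \<and> x \<in> set (other_cycle_starts i \<sigma>)}"
    let ?E = "{\<sigma>. \<sigma> permutes UNIV \<and> x \<notin> set (other_cycle_starts i \<sigma>)}"
    have split: "sum f {\<sigma>. \<sigma> permutes UNIV} = sum f ?D + sum f ?E" for f :: "('n \<Rightarrow> 'n) \<Rightarrow> quat"
      by (subst sum.union_disjoint[symmetric]) (auto intro!: sum.cong)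
    \<comment> \<open>The factor of the cycle of \<open>x\<close> sits between the factors \<open>us\<close> and \<open>vs\<close>, with which it need not commute.\<close>
    define us where "us \<sigma> = takeWhile (\<lambda>m. m \<noteq> x) (other_cycle_starts i \<sigma>)" for \<sigma>
    define vs where "vs \<sigma> = tl (dropWhile (\<lambda>m. m \<noteq> x) (other_cycle_starts i \<sigma>))" for \<sigma>
    have L: "other_cycle_starts i \<sigma> = us \<sigma> @ x # vs \<sigma>" if "x \<in> set (other_cycle_starts i \<sigma>)" for \<sigma>
    proof -
      have ne: "dropWhile (\<lambda>m. m \<noteq> x) (other_cycle_starts i \<sigma>) \<noteq> []"
        using that by simp
      then have "hd (dropWhile (\<lambda>m. m \<noteq> x) (other_cycle_starts i \<sigma>)) = x"
        using hd_dropWhile by blast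
      then have "dropWhile (\<lambda>m. m \<noteq> x) (other_cycle_starts i \<sigma>) = x # vs \<sigma>"
        using ne by (metis list.collapse vs_def)
      then show ?thesis
        by (metis takeWhile_dropWhile_id us_def)
    qed
    have notin: "x \<notin> set (us \<sigma>)" "x \<notin> set (vs \<sigma>)" if "x \<in> set (other_cycle_starts i \<sigma>)" for \<sigma>
      using distinct_other_cycle_starts[of i \<sigma>] unfolding L[OF that] by auto
    define a where "a \<sigma> = cycle_sign \<sigma> * h \<sigma> * prod_list (map (w S \<sigma>) (us \<sigma>))" for \<sigma>
    define b where "b \<sigma> = prod_list (map (w S \<sigma>) (vs \<sigma>))" for \<sigma>
    have FS: "F S \<sigma> = a \<sigma> * cycle_prod B \<sigma> x * b \<sigma>" if "x \<in> set (other_cycle_starts i \<sigma>)" for \<sigma>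
      using \<open>x \<notin> S\<close> unfolding F_def L[OF that] a_def b_def by (simp add: w_def mult.assoc)
    have Fx: "F (insert x S) \<sigma> = a \<sigma> * of_real (qre (cycle_prod B \<sigma> x)) * b \<sigma>"
      if "x \<in> set (other_cycle_starts i \<sigma>)" for \<sigma>
    proof -
      have "map (w (insert x S) \<sigma>) (us \<sigma>) = map (w S \<sigma>) (us \<sigma>)"
        "map (w (insert x S) \<sigma>) (vs \<sigma>) = map (w S \<sigma>) (vs \<sigma>)"
        using notin[OF that] by (auto simp: w_def)
      note eqs = this
      show ?thesis
        unfolding F_def L[OF that] a_def b_def map_append list.map eqs
        by (simp add: w_def[of _ _ x] mult.assoc)
    qed
    have inv_starts: "other_cycle_starts i (rev_cycle x \<sigma>) = other_cycle_starts i \<sigma>"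
      and inv_sign: "cycle_sign (rev_cycle x \<sigma>) = cycle_sign \<sigma>"
      if "\<sigma> permutes UNIV" for \<sigma>
      using other_cycle_starts_cong[OF orbit_rev_cycle[OF that]]
        cycle_sign_cong[OF orbit_rev_cycle[OF that]] by simp_all
    have inv_w: "w S (rev_cycle x \<sigma>) m = w S \<sigma> m"
      if "\<sigma> permutes UNIV" "x \<in> set (other_cycle_starts i \<sigma>)"
        "m \<in> set (other_cycle_starts i \<sigma>)" "m \<noteq> x" for \<sigma> m
      using cycle_prod_rev_cycle_other[OF that(1) other_cycle_starts_disjoint[OF that]]
      by (simp add: w_def)
    have inv_list: "map (w S (rev_cycle x \<sigma>)) (us \<sigma>) = map (w S \<sigma>) (us \<sigma>)"
      "map (w S (rev_cycle x \<sigma>)) (vs \<sigma>) = map (w S \<sigma>) (vs \<sigma>)" if "\<sigma> \<in> ?D" for \<sigma>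
    proof -
      have s: "x \<in> set (other_cycle_starts i \<sigma>)" and p: "\<sigma> permutes UNIV"
        using that by auto
      have sub: "set (us \<sigma>) \<union> set (vs \<sigma>) \<subseteq> set (other_cycle_starts i \<sigma>)"
        by (subst L[OF s]) auto
      show "map (w S (rev_cycle x \<sigma>)) (us \<sigma>) = map (w S \<sigma>) (us \<sigma>)"
        "map (w S (rev_cycle x \<sigma>)) (vs \<sigma>) = map (w S \<sigma>) (vs \<sigma>)"
        using sub notin[OF s] by (auto intro!: inv_w[OF p s])
    qed
    have "sum (F S) ?D = (\<Sum>\<sigma>\<in>?D. a \<sigma> * cycle_prod B \<sigma> x * b \<sigma>)"
      by (rule sum.cong) (simp_all add: FS)
    also have "\<dots> = (\<Sum>\<sigma>\<in>?D. a \<sigma> * of_real (qre (cycle_prod B \<sigma> x)) * b \<sigma>)"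
    proof (rule sum_involution_qre[where f = "rev_cycle x"])
      fix \<sigma> assume \<sigma>: "\<sigma> \<in> ?D"
      then have p: "\<sigma> permutes UNIV" and s: "x \<in> set (other_cycle_starts i \<sigma>)"
        by auto
      have us_eq: "us (rev_cycle x \<sigma>) = us \<sigma>" "vs (rev_cycle x \<sigma>) = vs \<sigma>"
        by (simp_all add: us_def vs_def inv_starts[OF p])
      have xi: "x \<notin> orbit \<sigma> i"
        using s by (simp add: set_other_cycle_starts)
      show "rev_cycle x \<sigma> \<in> ?D"
        using p s by (simp add: inv_starts rev_cycle_permutes)
      show "rev_cycle x (rev_cycle x \<sigma>) = \<sigma>"
        by (rule rev_cycle_rev_cycle[OF p])
      show "a (rev_cycle x \<sigma>) = a \<sigma>"
        by (simp add: a_def us_eq inv_list[OF \<sigma>] inv_sign[OF p] h[OF p xi])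
      show "b (rev_cycle x \<sigma>) = b \<sigma>"
        by (simp add: b_def us_eq inv_list[OF \<sigma>])
      have ni: "y \<noteq> i" if "y \<in> orbit \<sigma> x" for y
        using that xi in_orbit_commute[OF p] by blast
      show "cycle_prod B (rev_cycle x \<sigma>) x = qcnj (cycle_prod B \<sigma> x)"
        by (rule cycle_prod_rev_cycle[OF p _ self_in_orbit[OF p]]) (intro B ni)
    qed
    also have "\<dots> = sum (F (insert x S)) ?D"
      by (rule sum.cong) (simp_all add: Fx)
    finally have 1: "sum (F S) ?D = sum (F (insert x S)) ?D" .
    have 2: "sum (F S) ?E = sum (F (insert x S)) ?E"
    proof (rule sum.cong[OF refl])
      fix \<sigma> assume "\<sigma> \<in> ?E"
      then have "map (w (insert x S) \<sigma>) (other_cycle_starts i \<sigma>) = map (w S \<sigma>) (other_cycle_starts i \<sigma>)"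
        by (auto simp: w_def)
      then show "F S \<sigma> = F (insert x S) \<sigma>" by (simp only: F_def)
    qed
    show ?case using insert.IH 1 2 by (simp only: split[of "F S"] split[of "F (insert x S)"])
  qed simp
  from this[of UNIV] have "sum (F UNIV) {\<sigma>. \<sigma> permutes UNIV} = sum (F {}) {\<sigma>. \<sigma> permutes UNIV}"
    by simp
  moreover have "w {} \<sigma> = cycle_prod B \<sigma>" "w UNIV \<sigma> = (\<lambda>m. of_real (qre (cycle_prod B \<sigma> m)))" for \<sigma>
    by (simp_all add: w_def fun_eq_iff)
  ultimately show ?thesis
    by (simp add: F_def of_real_prod_distinct[OF distinct_other_cycle_starts])
qed

text \<open>
  Moving the starting point of a cycle permutes the factors cyclically, and the real part is
  invariant under cyclic permutations because \<open>Re (x y) = Re (y x)\<close>.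
\<close>

lemma qre_cycle_prod_eq:
  fixes \<sigma> :: "'n::finite \<Rightarrow> 'n"
  assumes \<sigma>: "\<sigma> permutes UNIV" and q: "q \<in> orbit \<sigma> p"
  shows "qre (cycle_prod B \<sigma> q) = qre (cycle_prod B \<sigma> p)"
proof -
  have nxt: "qre (cycle_prod B \<sigma> (\<sigma> x)) = qre (cycle_prod B \<sigma> x)" for x
  proof -
    obtain xs where xs: "is_cycle \<sigma> (x # xs)"
      using \<sigma> by (rule is_cycle_exists)
    show ?thesis
    proof (cases xs)
      case Nil
      with xs show ?thesis by (simp add: is_cycle_def)
    next
      case (Cons y ys)
      with xs have y: "\<sigma> x = y" by (simp add: is_cycle_def)
      have 2: "is_cycle \<sigma> (y # ys @ [x])"
        using is_cycle_rotate[OF xs] Cons by simp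
      show ?thesis
        unfolding y cycle_prod_is_cycle[OF 2] cycle_prod_is_cycle[OF xs]
        using qre_mult_commute[of "B $ x $ \<sigma> x" "\<Prod>q\<leftarrow>y # ys. B $ q $ \<sigma> q"] Cons
        by (simp add: mult.assoc)
    qed
  qed
  show ?thesis
    using q by (induction rule: orbit.induct) (simp_all add: nxt)
qed

definition cycle_starts :: "('n::{finite,linorder} \<Rightarrow> 'n) \<Rightarrow> 'n set" where
  "cycle_starts \<sigma> = {m. \<forall>q\<in>orbit \<sigma> m. m \<le> q}"

text \<open>
  The least elements of the cycles serve as arbitrary representatives, by \<open>qre_cycle_prod_eq\<close>.
\<close>

definition moore_det :: "'n::{finite,linorder} qmat \<Rightarrow> real" where
  "moore_det B = (\<Sum>\<sigma> | \<sigma> permutes UNIV. rsign \<sigma> * (\<Prod>m\<in>cycle_starts \<sigma>. qre (cycle_prod B \<sigma> m)))"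

lemma cycle_start_of:
  fixes \<sigma> :: "'n::{finite,linorder} \<Rightarrow> 'n"
  assumes \<sigma>: "\<sigma> permutes UNIV"
  obtains \<mu> where "\<mu> \<in> orbit \<sigma> x" "cycle_starts \<sigma> \<inter> orbit \<sigma> x = {\<mu>}"
proof
  have ne: "orbit \<sigma> x \<noteq> {}" by (rule orbit_nonempty)
  let ?\<mu> = "Min (orbit \<sigma> x)"
  show \<mu>: "?\<mu> \<in> orbit \<sigma> x"
    using ne by (intro Min_in) simp
  have "m = ?\<mu>" if "m \<in> cycle_starts \<sigma>" "m \<in> orbit \<sigma> x" for m
  proof (rule antisym)
    show "m \<le> ?\<mu>"
      using that \<mu> orbit_eq[OF \<sigma> that(2)] by (simp add: cycle_starts_def)
    show "?\<mu> \<le> m"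
      using that(2) by simp
  qed
  moreover have "?\<mu> \<in> cycle_starts \<sigma>"
    using orbit_eq[OF \<sigma> \<mu>] by (simp add: cycle_starts_def)
  ultimately show "cycle_starts \<sigma> \<inter> orbit \<sigma> x = {?\<mu>}"
    using \<mu> by blast
qed

lemma set_other_cycle_starts_conv: "set (other_cycle_starts i \<sigma>) = cycle_starts \<sigma> - orbit \<sigma> i"
  by (auto simp: set_other_cycle_starts cycle_starts_def)

text \<open>
  Exactly one representative lies in the cycle of \<open>k\<close>, and its cycle product has the same real
  part as the one started at \<open>k\<close>.
\<close>

lemma prod_qre_split_orbit:
  fixes \<sigma> :: "'n::{finite,linorder} \<Rightarrow> 'n"
  assumes \<sigma>: "\<sigma> permutes UNIV" and K: "\<And>m. m \<in> orbit \<sigma> k \<Longrightarrow> (m \<in> K \<longleftrightarrow> m \<in> cycle_starts \<sigma>)"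
  shows "(\<Prod>m\<in>K. qre (cycle_prod B \<sigma> m)) =
    qre (cycle_prod B \<sigma> k) * (\<Prod>m\<in>K - orbit \<sigma> k. qre (cycle_prod B \<sigma> m))"
proof -
  obtain \<mu> where \<mu>: "\<mu> \<in> orbit \<sigma> k" "cycle_starts \<sigma> \<inter> orbit \<sigma> k = {\<mu>}"
    using \<sigma> by (rule cycle_start_of)
  have "K = insert \<mu> (K - orbit \<sigma> k)"
    using \<mu> K by blast
  then have "(\<Prod>m\<in>K. qre (cycle_prod B \<sigma> m)) =
      (\<Prod>m\<in>insert \<mu> (K - orbit \<sigma> k). qre (cycle_prod B \<sigma> m))"
    by simp
  also have "\<dots> = qre (cycle_prod B \<sigma> \<mu>) * (\<Prod>m\<in>K - orbit \<sigma> k. qre (cycle_prod B \<sigma> m))"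
    using \<mu>(1) by (intro prod.insert) auto
  finally show ?thesis
    by (simp add: qre_cycle_prod_eq[OF \<sigma> \<mu>(1)])
qed

definition hermitian :: "'n::finite qmat \<Rightarrow> bool" where
  "hermitian B \<longleftrightarrow> ctransp B = B"

lemma hermitian_entry: "hermitian B \<Longrightarrow> B $ q $ p = qcnj (B $ p $ q)"
  unfolding hermitian_def ctransp_def vec_eq_iff vec_lambda_beta by (rule sym) blast

lemma rdet_conv:
  "rdet i B = (\<Sum>\<sigma> | \<sigma> permutes UNIV. cycle_sign \<sigma> * cycle_prod B \<sigma> i *
        prod_list (map (cycle_prod B \<sigma>) (other_cycle_starts i \<sigma>)))"
  by (simp add: rdet_def prod_list_row_factors mult.assoc)

text \<open>
  This covers matrices whose row \<open>i\<close> has been overwritten. The cycle of \<open>i\<close> may then pass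
  through entries without symmetry, so its product must stay as it is.
\<close>

lemma rdet_almost_hermitian:
  fixes B :: "'n::{finite,linorder} qmat"
  assumes B: "\<And>p q. p \<noteq> i \<Longrightarrow> q \<noteq> i \<Longrightarrow> B $ q $ p = qcnj (B $ p $ q)"
  shows "rdet i B = (\<Sum>\<sigma> | \<sigma> permutes UNIV. cycle_sign \<sigma> * cycle_prod B \<sigma> i *
        of_real (\<Prod>m\<in>cycle_starts \<sigma> - orbit \<sigma> i. qre (cycle_prod B \<sigma> m)))"
  unfolding rdet_conv set_other_cycle_starts_conv[symmetric]
proof (rule sum_other_cycles_qre[OF B])
  fix \<sigma> :: "'n \<Rightarrow> 'n" and x
  assume "\<sigma> permutes UNIV" "x \<notin> orbit \<sigma> i"
  then show "cycle_prod B (rev_cycle x \<sigma>) i = cycle_prod B \<sigma> i"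
    by (intro cycle_prod_rev_cycle_other) (auto simp: in_orbit_commute)
qed

text \<open>
  After the other cycles have been replaced by real numbers, these commute with everything, and
  reversing the cycle of \<open>i\<close> replaces the first factor by its real part as well. The outcome is
  symmetric in all cycles, so it no longer depends on \<open>i\<close>.
\<close>

lemma rdet_hermitian:
  fixes B :: "'n::{finite,linorder} qmat"
  assumes B: "hermitian B"
  shows "rdet i B = of_real (moore_det B)"
proof -
  let ?P = "{\<sigma> :: 'n \<Rightarrow> 'n. \<sigma> permutes UNIV}"
  define b where "b \<sigma> = (of_real (\<Prod>m\<in>cycle_starts \<sigma> - orbit \<sigma> i. qre (cycle_prod B \<sigma> m)) :: quat)"
    for \<sigma>
  have "rdet i B = (\<Sum>\<sigma>\<in>?P. cycle_sign \<sigma> * cycle_prod B \<sigma> i * b \<sigma>)"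
    unfolding b_def by (rule rdet_almost_hermitian) (rule hermitian_entry[OF B])
  also have "\<dots> = (\<Sum>\<sigma>\<in>?P. cycle_sign \<sigma> * of_real (qre (cycle_prod B \<sigma> i)) * b \<sigma>)"
  proof (rule sum_involution_qre[where f = "rev_cycle i"])
    fix \<sigma> :: "'n \<Rightarrow> 'n" assume "\<sigma> \<in> ?P"
    then have p: "\<sigma> permutes UNIV" by simp
    note o = orbit_rev_cycle[OF p]
    show "rev_cycle i \<sigma> \<in> ?P" "rev_cycle i (rev_cycle i \<sigma>) = \<sigma>"
      using p by (simp_all add: rev_cycle_permutes rev_cycle_rev_cycle)
    show "cycle_sign (rev_cycle i \<sigma>) = cycle_sign \<sigma>"
      by (rule cycle_sign_cong[OF o])
    have "(\<Prod>m\<in>cycle_starts \<sigma> - orbit \<sigma> i. qre (cycle_prod B (rev_cycle i \<sigma>) m)) =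
        (\<Prod>m\<in>cycle_starts \<sigma> - orbit \<sigma> i. qre (cycle_prod B \<sigma> m))"
      by (rule prod.cong) (simp_all add: cycle_prod_rev_cycle_other[OF p])
    then show "b (rev_cycle i \<sigma>) = b \<sigma>"
      by (simp add: b_def cycle_starts_def o)
    show "cycle_prod B (rev_cycle i \<sigma>) i = qcnj (cycle_prod B \<sigma> i)"
      by (rule cycle_prod_rev_cycle[OF p _ self_in_orbit[OF p]]) (rule hermitian_entry[OF B])
  qed
  also have "\<dots> = of_real (moore_det B)"
    unfolding moore_det_def of_real_sum
  proof (rule sum.cong[OF refl])
    fix \<sigma> :: "'n \<Rightarrow> 'n" assume "\<sigma> \<in> ?P"
    then have p: "\<sigma> permutes UNIV" by simp
    have split: "(\<Prod>m\<in>cycle_starts \<sigma>. qre (cycle_prod B \<sigma> m)) =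
        qre (cycle_prod B \<sigma> i) * (\<Prod>m\<in>cycle_starts \<sigma> - orbit \<sigma> i. qre (cycle_prod B \<sigma> m))"
      by (rule prod_qre_split_orbit[OF p]) simp
    show "cycle_sign \<sigma> * of_real (qre (cycle_prod B \<sigma> i)) * b \<sigma> =
        of_real (rsign \<sigma> * (\<Prod>m\<in>cycle_starts \<sigma>. qre (cycle_prod B \<sigma> m)))"
      unfolding cycle_sign_conv b_def split
      by (simp only: of_real_mult mult.assoc)
  qed
  finally show ?thesis .
qed

section \<open>Cofactors, and the duality of row and column determinants\<close>

lemma row_factors_split:
  fixes B :: "'n::{finite,linorder} qmat"
  assumes \<sigma>: "\<sigma> permutes UNIV"
  shows "row_factors i \<sigma> B = B $ i $ \<sigma> i # tl (row_factors i \<sigma> B)"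
proof -
  obtain xs where xs: "is_cycle \<sigma> (i # xs)"
    using \<sigma> by (rule is_cycle_exists)
  show ?thesis
    by (simp add: row_factors_def cycle_factors_is_cycle[OF xs])
qed

lemma tl_row_factors_cong:
  fixes B :: "'n::{finite,linorder} qmat"
  assumes \<sigma>: "\<sigma> permutes UNIV" and eq: "\<And>p q. p \<noteq> i \<Longrightarrow> B' $ p $ q = B $ p $ q"
  shows "tl (row_factors i \<sigma> B') = tl (row_factors i \<sigma> B)"
proof -
  obtain xs where xs: "is_cycle \<sigma> (i # xs)"
    using \<sigma> by (rule is_cycle_exists)
  then have "i \<notin> set xs" by (simp add: is_cycle_def)
  then have 1: "map (\<lambda>q. B' $ q $ \<sigma> q) xs = map (\<lambda>q. B $ q $ \<sigma> q) xs"
    by (intro map_cong refl eq) auto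
  have 2: "map (cycle_factors B' \<sigma>) (other_cycle_starts i \<sigma>) =
      map (cycle_factors B \<sigma>) (other_cycle_starts i \<sigma>)"
  proof (rule map_cong[OF refl])
    fix m assume m: "m \<in> set (other_cycle_starts i \<sigma>)"
    then have "y \<noteq> i" if "y \<in> orbit \<sigma> m" for y
      using that in_orbit_commute[OF \<sigma>] by (auto simp: set_other_cycle_starts)
    then show "cycle_factors B' \<sigma> m = cycle_factors B \<sigma> m"
      by (intro cycle_cong(2)[OF \<sigma> refl] eq)
  qed
  show ?thesis
    by (simp add: row_factors_def cycle_factors_is_cycle[OF xs] 1 2)
qed

text \<open>
  The first factor is the only one taken from row \<open>i\<close>, as \<open>i\<close> occurs once in its own cycle.
  Hence the cofactors along row \<open>i\<close> survive any change of that row, and \<open>rdet i\<close> is linear in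
  it.
\<close>

lemma right_cofactor_cong:
  fixes B :: "'n::{finite,linorder} qmat"
  assumes "\<And>p q. p \<noteq> i \<Longrightarrow> B' $ p $ q = B $ p $ q"
  shows "right_cofactor B' i q = right_cofactor B i q"
  unfolding right_cofactor_def using tl_row_factors_cong[OF _ assms] by (intro sum.cong) auto

lemma rdet_expand_row:
  fixes B :: "'n::{finite,linorder} qmat"
  shows "rdet i B = (\<Sum>q\<in>UNIV. B $ i $ q * right_cofactor B i q)"
proof -
  let ?P = "{\<sigma> :: 'n \<Rightarrow> 'n. \<sigma> permutes UNIV}"
  have "rdet i B = (\<Sum>\<sigma>\<in>?P. B $ i $ \<sigma> i * (cycle_sign \<sigma> * prod_list (tl (row_factors i \<sigma> B))))"
    unfolding rdet_def
  proof (rule sum.cong[OF refl])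
    fix \<sigma> :: "'n \<Rightarrow> 'n" assume "\<sigma> \<in> ?P"
    then have "\<sigma> permutes UNIV" by simp
    from row_factors_split[OF this, of i B]
    have "prod_list (row_factors i \<sigma> B) = B $ i $ \<sigma> i * prod_list (tl (row_factors i \<sigma> B))"
      by (metis prod_list.Cons)
    then show "cycle_sign \<sigma> * prod_list (row_factors i \<sigma> B) =
        B $ i $ \<sigma> i * (cycle_sign \<sigma> * prod_list (tl (row_factors i \<sigma> B)))"
      by (metis cycle_sign_conv mult.assoc of_real_mult_commute)
  qed
  also have "\<dots> = (\<Sum>q\<in>UNIV. \<Sum>\<sigma>\<in>{\<sigma>\<in>?P. \<sigma> i = q}.
      B $ i $ \<sigma> i * (cycle_sign \<sigma> * prod_list (tl (row_factors i \<sigma> B))))"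
    by (rule sum.group[symmetric]) auto
  also have "\<dots> = (\<Sum>q\<in>UNIV. B $ i $ q * right_cofactor B i q)"
    unfolding right_cofactor_def sum_distrib_left by (intro sum.cong) auto
  finally show ?thesis .
qed

lemma rdet_replace_row:
  fixes B :: "'n::{finite,linorder} qmat"
  shows "rdet i (replace_row i v B) = (\<Sum>q\<in>UNIV. v $ q * right_cofactor B i q)"
proof -
  have "right_cofactor (replace_row i v B) i q = right_cofactor B i q" for q
    by (rule right_cofactor_cong) (simp add: replace_row_def)
  then show ?thesis
    unfolding rdet_expand_row by (simp add: replace_row_def)
qed

text \<open>
  Inverting the permutation reverses each cycle, and the factors of column determinants list the
  cycles in the opposite order; so the factors for \<open>B\<close> are those for the conjugate transpose,
  read backwards and conjugated.
\<close>

lemma col_factors_inv: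
  fixes B :: "'n::{finite,linorder} qmat"
  assumes \<sigma>: "\<sigma> permutes UNIV"
  shows "col_factors j (inv \<sigma>) B = rev (map qcnj (row_factors j \<sigma> (ctransp B)))"
proof -
  have o: "orbit (inv \<sigma>) m = orbit \<sigma> m" for m
    using \<sigma> by (simp add: orbit_inv_eq permutes_UNIV_imp_permutation)
  have f: "cycle_factors B (inv \<sigma>) m = rev (map qcnj (cycle_factors (ctransp B) \<sigma> m))" for m
  proof -
    obtain xs where xs: "is_cycle \<sigma> (m # xs)"
      using \<sigma> by (rule is_cycle_exists)
    show ?thesis
      by (rule cycle_prod_inverse(1)[OF xs permutes_inj[OF \<sigma>] refl]) (simp add: ctransp_def)
  qed
  show ?thesis
    unfolding col_factors_def row_factors_def other_cycle_starts_cong[OF o]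
    by (simp add: f[abs_def] rev_concat rev_map map_concat comp_def)
qed

lemma cdet_conv_rdet:
  fixes B :: "'n::{finite,linorder} qmat"
  shows "cdet j B = qcnj (rdet j (ctransp B))"
  unfolding cdet_def rdet_def qcnj_sum
proof (rule sum.reindex_bij_witness[of _ inv inv])
  fix \<sigma> :: "'n \<Rightarrow> 'n" assume \<sigma>: "\<sigma> \<in> {\<sigma>. \<sigma> permutes UNIV}"
  then have p: "\<sigma> permutes UNIV" by simp
  show "inv (inv \<sigma>) = \<sigma>" "inv \<sigma> \<in> {\<sigma>. \<sigma> permutes UNIV}"
    using p by (simp_all add: permutes_inv permutes_inv_inv)
  have s: "cycle_sign (inv \<sigma>) = cycle_sign \<sigma>"
    using p by (intro cycle_sign_cong) (simp add: orbit_inv_eq permutes_UNIV_imp_permutation)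
  have "prod_list (col_factors j \<sigma> B) = qcnj (prod_list (row_factors j (inv \<sigma>) (ctransp B)))"
    using col_factors_inv[OF permutes_inv[OF p], of j B]
    by (simp add: permutes_inv_inv[OF p] qcnj_prod_list rev_map)
  then show "qcnj (cycle_sign (inv \<sigma>) * prod_list (row_factors j (inv \<sigma>) (ctransp B))) =
      cycle_sign \<sigma> * prod_list (col_factors j \<sigma> B)"
    unfolding s by (simp add: cycle_sign_conv of_real_mult_commute)
qed (auto simp: permutes_inv permutes_inv_inv)

lemma left_cofactor_conv_right_cofactor:
  fixes B :: "'n::{finite,linorder} qmat"
  shows "left_cofactor B q j = qcnj (right_cofactor (ctransp B) j q)"
  unfolding left_cofactor_def right_cofactor_def qcnj_sum
proof (rule sum.reindex_bij_witness[of _ inv inv])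
  fix \<sigma> :: "'n \<Rightarrow> 'n" assume \<sigma>: "\<sigma> \<in> {\<sigma>. \<sigma> permutes UNIV \<and> \<sigma> q = j}"
  then have p: "\<sigma> permutes UNIV" by simp
  show "inv (inv \<sigma>) = \<sigma>" "inv \<sigma> \<in> {\<sigma>. \<sigma> permutes UNIV \<and> \<sigma> j = q}"
    using p \<sigma> by (auto simp: permutes_inv permutes_inv_inv permutes_inverses)
  have s: "cycle_sign (inv \<sigma>) = cycle_sign \<sigma>"
    using p by (intro cycle_sign_cong) (simp add: orbit_inv_eq permutes_UNIV_imp_permutation)
  have "prod_list (butlast (col_factors j \<sigma> B)) = qcnj (prod_list (tl (row_factors j (inv \<sigma>) (ctransp B))))"
    using col_factors_inv[OF permutes_inv[OF p], of j B]
    by (simp add: permutes_inv_inv[OF p] qcnj_prod_list rev_map butlast_rev map_tl flip: map_butlast)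
  then show "qcnj (cycle_sign (inv \<sigma>) * prod_list (tl (row_factors j (inv \<sigma>) (ctransp B)))) =
      cycle_sign \<sigma> * prod_list (butlast (col_factors j \<sigma> B))"
    unfolding s by (simp add: cycle_sign_conv of_real_mult_commute)
qed (auto simp: permutes_inv permutes_inv_inv permutes_inverses)

section \<open>A repeated row\<close>

lemma is_cycle_merge:
  assumes "is_cycle \<sigma> (i # us)" "is_cycle \<sigma> (k # vs)" "set (i # us) \<inter> set (k # vs) = {}"
  shows "is_cycle (\<sigma> \<circ> Transposition.transpose i k) (i # vs @ k # us)"
proof -
  have i: "\<sigma> i # map \<sigma> us = us @ [i]" and k: "\<sigma> k # map \<sigma> vs = vs @ [k]"
    and d: "distinct (i # us)" "distinct (k # vs)"
    using assms(1,2) by (auto simp: is_cycle_def)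
  have "map (\<sigma> \<circ> Transposition.transpose i k) us = map \<sigma> us" "map (\<sigma> \<circ> Transposition.transpose i k) vs = map \<sigma> vs"
    using d assms(3) by (auto simp: Transposition.transpose_def)
  then have "map (\<sigma> \<circ> Transposition.transpose i k) (i # vs @ k # us) = (\<sigma> k # map \<sigma> vs) @ (\<sigma> i # map \<sigma> us)"
    by simp
  also have "\<dots> = rotate1 (i # vs @ k # us)"
    unfolding i k by simp
  finally show ?thesis
    using d assms(3) by (auto simp: is_cycle_def)
qed

lemma is_cycle_split:
  assumes "is_cycle \<sigma> (i # vs @ k # us)"
  shows "is_cycle (\<sigma> \<circ> Transposition.transpose i k) (i # us)"
proof -
  have d: "distinct (i # vs @ k # us)"
    and rot: "(\<sigma> i # map \<sigma> vs) @ \<sigma> k # map \<sigma> us = (vs @ [k]) @ us @ [i]"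
    using assms by (auto simp: is_cycle_def)
  then have k: "\<sigma> k # map \<sigma> us = us @ [i]"
    by (subst (asm) append_eq_append_conv) simp_all
  have "map (\<sigma> \<circ> Transposition.transpose i k) us = map \<sigma> us"
    using d by (auto simp: Transposition.transpose_def)
  moreover have "map (\<sigma> \<circ> Transposition.transpose i k) (i # us) =
      \<sigma> k # map (\<sigma> \<circ> Transposition.transpose i k) us"
    by simp
  ultimately have "map (\<sigma> \<circ> Transposition.transpose i k) (i # us) = rotate1 (i # us)"
    using k by (simp only: rotate1.simps)
  then show ?thesis
    using d by (auto simp: is_cycle_def)
qed

lemma comp_transpose_permutes:
  "\<sigma> permutes UNIV \<Longrightarrow> (\<sigma> \<circ> Transposition.transpose i k) permutes UNIV"
  by (intro permutes_compose permutes_swap_id) simp_all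

context
  fixes \<sigma> :: "'n::{finite,linorder} \<Rightarrow> 'n" and i k :: 'n
  assumes \<sigma>: "\<sigma> permutes UNIV" and k: "k \<notin> orbit \<sigma> i"
begin

lemma orbits_disjoint: "orbit \<sigma> i \<inter> orbit \<sigma> k = {}"
  using \<sigma> k by (metis disjoint_iff in_orbit_commute orbit_eq)

text \<open>
  Composition with the transposition merges the cycles \<open>(i, us)\<close> and \<open>(k, vs)\<close> into
  \<open>(i, vs, k, us)\<close> and leaves the rest alone.
\<close>

lemma orbit_comp_transpose:
  "orbit (\<sigma> \<circ> Transposition.transpose i k) m =
    (if m \<in> orbit \<sigma> i \<union> orbit \<sigma> k then orbit \<sigma> i \<union> orbit \<sigma> k else orbit \<sigma> m)"
proof -
  let ?t = "\<sigma> \<circ> Transposition.transpose i k"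
  obtain us where us: "is_cycle \<sigma> (i # us)" using \<sigma> by (rule is_cycle_exists)
  obtain vs where vs: "is_cycle \<sigma> (k # vs)" using \<sigma> by (rule is_cycle_exists)
  note o = orbit_is_cycle_Cons[OF us] orbit_is_cycle_Cons[OF vs]
  have c: "is_cycle ?t (i # vs @ k # us)"
    using orbits_disjoint unfolding o by (rule is_cycle_merge[OF us vs])
  have oi: "orbit ?t i = orbit \<sigma> i \<union> orbit \<sigma> k"
    unfolding orbit_is_cycle_Cons[OF c] o by auto
  show ?thesis
  proof (cases "m \<in> orbit \<sigma> i \<union> orbit \<sigma> k")
    case True
    then show ?thesis
      using orbit_eq[OF comp_transpose_permutes[OF \<sigma>], of m i k i] oi by simp
  next
    case False
    then have "?t y = \<sigma> y" if "y \<in> orbit \<sigma> m" for y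
      using that in_orbit_commute[OF \<sigma>, of m] by (auto simp: Transposition.transpose_def)
    then show ?thesis
      using False cycle_cong(1)[OF \<sigma>, of m ?t 0 0] by simp
  qed
qed

text \<open>
  The merged cycle replaces two cycles, so their number drops by one.
\<close>

lemma cycle_sign_comp_transpose: "cycle_sign (\<sigma> \<circ> Transposition.transpose i k) = - cycle_sign \<sigma>"
proof -
  let ?t = "\<sigma> \<circ> Transposition.transpose i k"
  let ?R = "range (orbit \<sigma>) - {orbit \<sigma> i, orbit \<sigma> k}"
  have ne: "orbit \<sigma> i \<noteq> orbit \<sigma> k"
    using k self_in_orbit[OF \<sigma>] by blast
  have "orbit \<sigma> m \<in> {orbit \<sigma> i, orbit \<sigma> k}" if "m \<in> orbit \<sigma> i \<union> orbit \<sigma> k" for m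
    using that orbit_eq[OF \<sigma>] by blast
  moreover have "m \<in> orbit \<sigma> i \<union> orbit \<sigma> k" if "orbit \<sigma> m \<in> {orbit \<sigma> i, orbit \<sigma> k}" for m
    using that self_in_orbit[OF \<sigma>, of m] by auto
  ultimately have "{m. orbit \<sigma> m \<notin> {orbit \<sigma> i, orbit \<sigma> k}} = - (orbit \<sigma> i \<union> orbit \<sigma> k)"
    by (intro set_eqI) (metis (no_types, lifting) ComplD ComplI mem_Collect_eq)
  moreover have "?R = orbit \<sigma> ` {m. orbit \<sigma> m \<notin> {orbit \<sigma> i, orbit \<sigma> k}}"
    by auto
  ultimately have R: "?R = orbit \<sigma> ` (- (orbit \<sigma> i \<union> orbit \<sigma> k))"
    by simp
  have "orbit ?t i = orbit \<sigma> i \<union> orbit \<sigma> k"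
    using self_in_orbit[OF \<sigma>, of i] by (simp add: orbit_comp_transpose)
  then have "range (orbit ?t) = insert (orbit \<sigma> i \<union> orbit \<sigma> k) ?R"
    unfolding R by (auto simp: orbit_comp_transpose image_iff)
  moreover have "orbit \<sigma> i \<union> orbit \<sigma> k \<notin> ?R"
  proof
    assume "orbit \<sigma> i \<union> orbit \<sigma> k \<in> ?R"
    then obtain m where m: "orbit \<sigma> i \<union> orbit \<sigma> k = orbit \<sigma> m" by auto
    then have "i \<in> orbit \<sigma> m" "k \<in> orbit \<sigma> m"
      using self_in_orbit[OF \<sigma>] by blast+
    then show False
      using ne orbit_eq[OF \<sigma>] by blast
  qed
  ultimately have 1: "card (range (orbit ?t)) = Suc (card ?R)"
    by simp
  have "range (orbit \<sigma>) = insert (orbit \<sigma> i) (insert (orbit \<sigma> k) ?R)"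
    by auto
  also have "card \<dots> = Suc (Suc (card ?R))"
    using ne by simp
  finally have 2: "card (range (orbit \<sigma>)) = Suc (Suc (card ?R))" .
  have "card (range (orbit \<sigma>)) \<le> CARD('n)"
    by (rule card_image_le) simp
  then have "CARD('n) - card (range (orbit ?t)) = Suc (CARD('n) - card (range (orbit \<sigma>)))"
    using 1 2 by simp
  then show ?thesis
    unfolding cycle_sign_def by simp
qed

text \<open>
  Along the merged cycle \<open>(i, vs, k, us)\<close>, the entry at \<open>i\<close> is read from row \<open>k\<close>, so the first
  part is the product of the original \<open>k\<close>-cycle; the remaining part starts at \<open>k\<close>, whose row is
  also the new row \<open>i\<close>, so it is the product of the original \<open>i\<close>-cycle.
\<close>

lemma cycle_prod_comp_transpose:
  "cycle_prod (replace_row i (row k B) B) (\<sigma> \<circ> Transposition.transpose i k) i =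
    cycle_prod B \<sigma> k * cycle_prod (replace_row i (row k B) B) \<sigma> i"
proof -
  let ?t = "\<sigma> \<circ> Transposition.transpose i k" and ?B = "replace_row i (row k B) B"
  obtain us where us: "is_cycle \<sigma> (i # us)" using \<sigma> by (rule is_cycle_exists)
  obtain vs where vs: "is_cycle \<sigma> (k # vs)" using \<sigma> by (rule is_cycle_exists)
  note o = orbit_is_cycle_Cons[OF us] orbit_is_cycle_Cons[OF vs]
  have c: "is_cycle ?t (i # vs @ k # us)"
    using orbits_disjoint unfolding o by (rule is_cycle_merge[OF us vs])
  then have d: "distinct (i # vs @ k # us)" by (simp add: is_cycle_def)
  have eqs: "map (\<lambda>q. ?B $ q $ ?t q) vs = map (\<lambda>q. B $ q $ \<sigma> q) vs"
    "map (\<lambda>q. ?B $ q $ ?t q) us = map (\<lambda>q. ?B $ q $ \<sigma> q) us"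
    using d by (auto simp: replace_row_def Transposition.transpose_def)
  have ik: "?B $ i $ ?t i = B $ k $ \<sigma> k" "?B $ k $ ?t k = ?B $ i $ \<sigma> i"
    using d by (simp_all add: replace_row_def row_def)
  show ?thesis
    unfolding cycle_prod_is_cycle[OF c] cycle_prod_is_cycle[OF us] cycle_prod_is_cycle[OF vs]
      list.map map_append eqs ik by (simp add: mult.assoc)
qed

lemma cycle_starts_comp_transpose:
  "cycle_starts (\<sigma> \<circ> Transposition.transpose i k) - orbit (\<sigma> \<circ> Transposition.transpose i k) i =
    cycle_starts \<sigma> - orbit \<sigma> i - orbit \<sigma> k"
  using self_in_orbit[OF \<sigma>, of i] by (auto simp: cycle_starts_def orbit_comp_transpose)

lemma cycle_prod_comp_transpose_other:
  assumes "m \<notin> orbit \<sigma> i" "m \<notin> orbit \<sigma> k"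
  shows "cycle_prod B (\<sigma> \<circ> Transposition.transpose i k) m = cycle_prod B \<sigma> m"
proof (rule cycle_cong(3)[OF \<sigma> _ refl])
  fix y assume "y \<in> orbit \<sigma> m"
  then have "y \<noteq> i" "y \<noteq> k"
    using assms in_orbit_commute[OF \<sigma>, of m] by auto
  then show "(\<sigma> \<circ> Transposition.transpose i k) y = \<sigma> y"
    by (simp add: Transposition.transpose_def)
qed

end

lemma comp_transpose_splits:
  fixes \<sigma> :: "'n::{finite,linorder} \<Rightarrow> 'n"
  assumes \<sigma>: "\<sigma> permutes UNIV" and k: "k \<in> orbit \<sigma> i" "i \<noteq> k"
  shows "k \<notin> orbit (\<sigma> \<circ> Transposition.transpose i k) i"
proof -
  obtain xs where xs: "is_cycle \<sigma> (i # xs)" using \<sigma> by (rule is_cycle_exists)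
  then have "k \<in> set xs"
    using k by (auto simp: orbit_is_cycle_Cons)
  then obtain vs us where "xs = vs @ k # us"
    by (meson split_list)
  with xs have c: "is_cycle \<sigma> (i # vs @ k # us)" by simp
  then show ?thesis
    using k(2) unfolding orbit_is_cycle_Cons[OF is_cycle_split[OF c]] by (auto simp: is_cycle_def)
qed

text \<open>
  The permutations that separate \<open>i\<close> from \<open>k\<close> are in bijection with those that do not, by
  composition with the transposition. Corresponding terms have opposite signs and differ only in
  that the first contains the real part of the product over the \<open>k\<close>-cycle and the second
  contains this product itself. Reversal of the \<open>k\<close>-cycle shows that the two sums agree.
\<close>

lemma rdet_repeated_row:
  fixes B :: "'n::{finite,linorder} qmat"
  assumes B: "hermitian B" and ik: "i \<noteq> k"
  shows "rdet i (replace_row i (row k B) B) = 0"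
proof -
  let ?B = "replace_row i (row k B) B" and ?P = "{\<sigma> :: 'n \<Rightarrow> 'n. \<sigma> permutes UNIV}"
  let ?D = "{\<sigma> :: 'n \<Rightarrow> 'n. \<sigma> permutes UNIV \<and> k \<notin> orbit \<sigma> i}"
  let ?E = "{\<sigma> :: 'n \<Rightarrow> 'n. \<sigma> permutes UNIV \<and> k \<in> orbit \<sigma> i}"
  let ?t = "\<lambda>\<sigma>. \<sigma> \<circ> Transposition.transpose i k"
  define F where "F \<sigma> = cycle_sign \<sigma> * cycle_prod ?B \<sigma> i *
    of_real (\<Prod>m\<in>cycle_starts \<sigma> - orbit \<sigma> i. qre (cycle_prod ?B \<sigma> m))" for \<sigma>
  define N where "N \<sigma> = (\<Prod>m\<in>cycle_starts \<sigma> - orbit \<sigma> i - orbit \<sigma> k. qre (cycle_prod B \<sigma> m))" for \<sigma>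
  define b where "b \<sigma> = cycle_prod ?B \<sigma> i * of_real (N \<sigma>)" for \<sigma>
  have off: "cycle_prod ?B \<sigma> m = cycle_prod B \<sigma> m" if "\<sigma> permutes UNIV" "m \<notin> orbit \<sigma> i" for \<sigma> m
  proof (rule cycle_cong(3)[OF that(1) refl])
    fix y assume "y \<in> orbit \<sigma> m"
    then have "y \<noteq> i" using that in_orbit_commute[OF that(1), of m] by auto
    then show "?B $ y $ \<sigma> y = B $ y $ \<sigma> y" by (simp add: replace_row_def)
  qed
  have D: "F \<sigma> = cycle_sign \<sigma> * of_real (qre (cycle_prod B \<sigma> k)) * b \<sigma>" if "\<sigma> \<in> ?D" for \<sigma>
  proof -
    have p: "\<sigma> permutes UNIV" and k: "k \<notin> orbit \<sigma> i" using that by auto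
    have "(\<Prod>m\<in>cycle_starts \<sigma> - orbit \<sigma> i. qre (cycle_prod ?B \<sigma> m)) =
        (\<Prod>m\<in>cycle_starts \<sigma> - orbit \<sigma> i. qre (cycle_prod B \<sigma> m))"
      by (rule prod.cong) (simp_all add: off[OF p])
    also have "\<dots> = qre (cycle_prod B \<sigma> k) * N \<sigma>"
      unfolding N_def using orbits_disjoint[OF p k] by (intro prod_qre_split_orbit[OF p]) auto
    finally show ?thesis
      unfolding F_def b_def
      by (simp add: mult.assoc of_real_mult_commute[of "qre (cycle_prod B \<sigma> k)"])
  qed
  have E: "F (?t \<sigma>) = - (cycle_sign \<sigma> * cycle_prod B \<sigma> k * b \<sigma>)" if "\<sigma> \<in> ?D" for \<sigma>
  proof -
    have p: "\<sigma> permutes UNIV" and k: "k \<notin> orbit \<sigma> i" using that by auto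
    have "(\<Prod>m\<in>cycle_starts (?t \<sigma>) - orbit (?t \<sigma>) i. qre (cycle_prod ?B (?t \<sigma>) m)) = N \<sigma>"
      unfolding N_def cycle_starts_comp_transpose[OF p k]
      by (rule prod.cong) (simp_all add: cycle_prod_comp_transpose_other[OF p k] off[OF p])
    then show ?thesis
      by (simp add: F_def b_def cycle_prod_comp_transpose[OF p k]
          cycle_sign_comp_transpose[OF p k] mult.assoc)
  qed
  have involution: "?t (?t \<sigma>) = \<sigma>" for \<sigma> :: "'n \<Rightarrow> 'n"
    by (simp add: comp_assoc)
  have "rdet i ?B = sum F ?P"
    unfolding F_def
  proof (rule rdet_almost_hermitian)
    fix p q assume "p \<noteq> i" "q \<noteq> i"
    then have "?B $ q $ p = B $ q $ p" "?B $ p $ q = B $ p $ q"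
      by (simp_all add: replace_row_def)
    then show "?B $ q $ p = qcnj (?B $ p $ q)"
      using hermitian_entry[OF B, of q p] by metis
  qed
  also have "?P = ?D \<union> ?E"
    by auto
  also have "sum F (?D \<union> ?E) = sum F ?D + sum F ?E"
    by (rule sum.union_disjoint) (simp_all add: disjoint_iff)
  also have "sum F ?E = (\<Sum>\<sigma>\<in>?D. F (?t \<sigma>))"
  proof (rule sum.reindex_bij_witness[of _ ?t ?t])
    fix \<sigma> :: "'n \<Rightarrow> 'n" assume "\<sigma> \<in> ?E"
    then show "?t \<sigma> \<in> ?D"
      using comp_transpose_splits ik by (auto intro: comp_transpose_permutes)
  next
    fix \<sigma> :: "'n \<Rightarrow> 'n" assume "\<sigma> \<in> ?D"
    then show "?t \<sigma> \<in> ?E"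
      using self_in_orbit[of \<sigma> i] self_in_orbit[of \<sigma> k]
      by (auto intro: comp_transpose_permutes simp: orbit_comp_transpose)
  qed (simp_all add: involution)
  also have "\<dots> = - (\<Sum>\<sigma>\<in>?D. cycle_sign \<sigma> * cycle_prod B \<sigma> k * b \<sigma>)"
    unfolding sum_negf[symmetric] by (rule sum.cong[OF refl E])
  also have "(\<Sum>\<sigma>\<in>?D. cycle_sign \<sigma> * cycle_prod B \<sigma> k * b \<sigma>) =
      (\<Sum>\<sigma>\<in>?D. cycle_sign \<sigma> * of_real (qre (cycle_prod B \<sigma> k)) * b \<sigma>)"
  proof (rule sum_involution_qre[where f = "rev_cycle k"])
    fix \<sigma> :: "'n \<Rightarrow> 'n" assume \<sigma>: "\<sigma> \<in> ?D"
    then have p: "\<sigma> permutes UNIV" and k: "k \<notin> orbit \<sigma> i" by auto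
    note o = orbit_rev_cycle[OF p]
    show "rev_cycle k \<sigma> \<in> ?D" "rev_cycle k (rev_cycle k \<sigma>) = \<sigma>"
      using \<sigma> by (simp_all add: rev_cycle_permutes rev_cycle_rev_cycle o)
    show "cycle_sign (rev_cycle k \<sigma>) = cycle_sign \<sigma>"
      by (rule cycle_sign_cong[OF o])
    have "(\<Prod>m\<in>cycle_starts \<sigma> - orbit \<sigma> i - orbit \<sigma> k. qre (cycle_prod B (rev_cycle k \<sigma>) m)) =
        (\<Prod>m\<in>cycle_starts \<sigma> - orbit \<sigma> i - orbit \<sigma> k. qre (cycle_prod B \<sigma> m))"
      by (rule prod.cong) (simp_all add: cycle_prod_rev_cycle_other[OF p])
    moreover have "cycle_prod ?B (rev_cycle k \<sigma>) i = cycle_prod ?B \<sigma> i"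
      using k by (intro cycle_prod_rev_cycle_other[OF p]) (simp add: in_orbit_commute[OF p])
    ultimately show "b (rev_cycle k \<sigma>) = b \<sigma>"
      by (simp add: b_def N_def cycle_starts_def o)
    show "cycle_prod B (rev_cycle k \<sigma>) k = qcnj (cycle_prod B \<sigma> k)"
      by (rule cycle_prod_rev_cycle[OF p _ self_in_orbit[OF p]]) (rule hermitian_entry[OF B])
  qed
  also have "\<dots> = sum F ?D"
    by (rule sum.cong[OF refl D[symmetric]])
  finally show ?thesis by simp
qed

section \<open>Conjugate transposes, inverses and the real trace\<close>

lemma ctransp_simps [simp]:
  "ctransp (ctransp A) = A" "ctransp (A + B) = ctransp A + ctransp B"
  "ctransp (r *\<^sub>R A) = r *\<^sub>R ctransp A" "ctransp (mat 1) = mat 1"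
  by (auto simp: ctransp_def vec_eq_iff mat_def)

lemma ctransp_entry: "ctransp A $ i $ j = qcnj (A $ j $ i)"
  by (simp add: ctransp_def)

lemma matrix_mult_entry: "(A ** B) $ i $ j = (\<Sum>k\<in>UNIV. A $ i $ k * B $ k $ j)"
  by (simp add: matrix_matrix_mult_def)

lemma matrix_add_rdistrib:
  fixes A B C :: "'n::finite qmat"
  shows "(A + B) ** C = A ** C + B ** C"
  by (simp add: vec_eq_iff matrix_mult_entry distrib_right sum.distrib)

lemma ctransp_mult: "ctransp (A ** B) = ctransp B ** ctransp A"
  by (simp add: ctransp_def vec_eq_iff matrix_matrix_mult_def qcnj_sum)

lemma scaleR_matrix_mult:
  fixes A B :: "'n::finite qmat"
  shows "(r *\<^sub>R A) ** B = r *\<^sub>R (A ** B)" "A ** (r *\<^sub>R B) = r *\<^sub>R (A ** B)"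
  by (simp_all add: vec_eq_iff matrix_matrix_mult_def scaleR_sum_right)

lemma matrix_inv_eqI:
  fixes A :: "'n::finite qmat"
  assumes "A ** C = mat 1" "C ** A = mat 1"
  shows "matrix_inv A = C"
proof -
  have "A ** matrix_inv A = mat 1 \<and> matrix_inv A ** A = mat 1"
    unfolding matrix_inv_def by (rule someI) (use assms in blast)
  then show ?thesis
    using assms by (metis matrix_mul_assoc matrix_mul_lid matrix_mul_rid)
qed

lemma left_inverse_eq_right_inverse:
  fixes A :: "'n::finite qmat"
  assumes "C ** A = mat 1" "A ** D = mat 1"
  shows "C = D"
  using assms by (metis matrix_mul_assoc matrix_mul_lid matrix_mul_rid)

definition re_trace :: "'n::finite qmat \<Rightarrow> real" where
  "re_trace A = (\<Sum>i\<in>UNIV. qre (A $ i $ i))"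

lemma re_trace_simps:
  "re_trace (A + B) = re_trace A + re_trace B" "re_trace (r *\<^sub>R A) = r * re_trace A"
  "re_trace (ctransp A) = re_trace A" "re_trace (mat 1 :: 'n::finite qmat) = real CARD('n)"
  by (simp_all add: re_trace_def sum.distrib sum_distrib_left ctransp_def mat_def)

text \<open>
  The trace itself is not invariant under cyclic permutations over the quaternions; only its
  real part is.
\<close>

lemma re_trace_mult_commute: "re_trace (A ** B) = re_trace (B ** A)"
proof -
  have "re_trace (A ** B) = (\<Sum>i\<in>UNIV. \<Sum>k\<in>UNIV. qre (B $ k $ i * A $ i $ k))"
    by (simp add: re_trace_def matrix_matrix_mult_def qre_sum qre_mult_commute)
  also have "\<dots> = re_trace (B ** A)"
    by (subst sum.swap) (simp add: re_trace_def matrix_matrix_mult_def qre_sum)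
  finally show ?thesis .
qed

lemma hermitian_simps:
  "hermitian (ctransp A ** A)" "hermitian (A ** ctransp A)"
  "hermitian B \<Longrightarrow> hermitian (B + t *\<^sub>R mat 1)"
  by (simp_all add: hermitian_def ctransp_mult)

section \<open>Adjugates of Hermitian matrices\<close>

text \<open>
  The adjugate: for Hermitian \<open>B\<close>, both \<open>B ** right_adj B\<close> and \<open>left_adj B ** B\<close> are \<open>det B\<close>
  times the identity. Once \<open>det B \<noteq> 0\<close>, the two adjugates must therefore agree.
\<close>

definition right_adj :: "'n::{finite,linorder} qmat \<Rightarrow> 'n qmat" where
  "right_adj B = (\<chi> q i. right_cofactor B i q)"

definition left_adj :: "'n::{finite,linorder} qmat \<Rightarrow> 'n qmat" where
  "left_adj B = ctransp (right_adj B)"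

text \<open>
  The entry at \<open>(k, i)\<close> expands \<open>B\<close>, with row \<open>i\<close> overwritten by row \<open>k\<close>, along row \<open>i\<close>: this is
  the determinant for \<open>k = i\<close>, and it vanishes otherwise.
\<close>

lemma mult_right_adj:
  assumes B: "hermitian B"
  shows "B ** right_adj B = moore_det B *\<^sub>R mat 1"
proof -
  have "(B ** right_adj B) $ k $ i = (moore_det B *\<^sub>R mat 1) $ k $ i" for k i
  proof -
    have "(B ** right_adj B) $ k $ i = rdet i (replace_row i (row k B) B)"
      by (simp add: matrix_matrix_mult_def right_adj_def rdet_replace_row row_def)
    also have "\<dots> = (moore_det B *\<^sub>R mat 1) $ k $ i"
    proof (cases "k = i")
      case True
      have "replace_row i (row i B) B = B"
        by (simp add: replace_row_def row_def vec_eq_iff)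
      then show ?thesis
        using True by (simp add: rdet_hermitian[OF B] mat_def of_real_def)
    next
      case False
      then show ?thesis
        by (simp add: rdet_repeated_row[OF B] mat_def)
    qed
    finally show ?thesis .
  qed
  then show ?thesis by (simp add: vec_eq_iff)
qed

lemma left_adj_mult:
  assumes B: "hermitian B"
  shows "left_adj B ** B = moore_det B *\<^sub>R mat 1"
proof -
  have "left_adj B ** B = ctransp (B ** right_adj B)"
    using B by (simp add: left_adj_def ctransp_mult hermitian_def)
  then show ?thesis by (simp add: mult_right_adj[OF B])
qed

lemma matrix_inv_hermitian:
  assumes B: "hermitian B" and d: "moore_det B \<noteq> 0"
  shows "invertible B" "matrix_inv B = (1 / moore_det B) *\<^sub>R left_adj B"
    "matrix_inv B = (1 / moore_det B) *\<^sub>R right_adj B"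
    "matrix_inv B ** B = mat 1" "B ** matrix_inv B = mat 1"
proof -
  let ?L = "(1 / moore_det B) *\<^sub>R left_adj B" and ?R = "(1 / moore_det B) *\<^sub>R right_adj B"
  have L: "?L ** B = mat 1" and R: "B ** ?R = mat 1"
    using d by (simp_all add: scaleR_matrix_mult left_adj_mult[OF B] mult_right_adj[OF B])
  then have eq: "?L = ?R" by (rule left_inverse_eq_right_inverse)
  show "invertible B"
    unfolding invertible_def using L R eq by auto
  show inv: "matrix_inv B = ?L"
    by (rule matrix_inv_eqI[OF R[folded eq] L])
  then show "matrix_inv B = ?R" using eq by simp
  show "matrix_inv B ** B = mat 1" "B ** matrix_inv B = mat 1"
    using L R eq by (simp_all only: inv)
qed

section \<open>Polynomials with vanishing Wronskian\<close>

text \<open>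
  If neither polynomial is constant, compare leading coefficients: those of the two sides are
  \<open>deg p\<close> and \<open>deg q\<close> times the same nonzero number. If one of them is constant, then so is the
  other.
\<close>

lemma wronskian_zero_imp_degree_eq:
  fixes p q :: "real poly"
  assumes "p \<noteq> 0" "q \<noteq> 0" and w: "pderiv p * q = p * pderiv q"
  shows "degree p = degree q"
proof (cases "pderiv p = 0 \<or> pderiv q = 0")
  case True
  then have "pderiv p = 0" "pderiv q = 0"
    using assms by auto
  then show ?thesis
    by (simp add: pderiv_eq_0_iff)
next
  case False
  have lc: "lead_coeff (pderiv r) = real (degree r) * lead_coeff r" if "pderiv r \<noteq> 0" for r :: "real poly"
  proof -
    have "degree r > 0" using that by (simp add: pderiv_eq_0_iff)
    then show ?thesis by (simp add: degree_pderiv coeff_pderiv)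
  qed
  have "lead_coeff (pderiv p) * lead_coeff q = lead_coeff p * lead_coeff (pderiv q)"
    using w by (metis lead_coeff_mult)
  then show ?thesis
    using False assms(1,2) lc[of p] lc[of q] by simp
qed

text \<open>
  Otherwise the difference \<open>d\<close> of the two sides is nonzero and has zero Wronskian with \<open>q\<close> as
  well, so it has the degree of \<open>q\<close>; but the leading coefficients cancel in \<open>d\<close>.
\<close>

lemma wronskian_zero_imp_proportional:
  fixes p q :: "real poly"
  assumes "p \<noteq> 0" "q \<noteq> 0" and w: "pderiv p * q = p * pderiv q"
  shows "smult (lead_coeff q) p = smult (lead_coeff p) q"
proof (rule ccontr)
  assume neq: "\<not> ?thesis"
  define d where "d = smult (lead_coeff q) p - smult (lead_coeff p) q"
  have "d \<noteq> 0" using neq by (simp add: d_def)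
  have pq: "degree p = degree q"
    using assms by (rule wronskian_zero_imp_degree_eq)
  have "pderiv d * q = d * pderiv q"
    using w by (simp add: d_def pderiv_diff pderiv_smult algebra_simps)
  with \<open>d \<noteq> 0\<close> assms(2) have "degree d = degree q"
    by (rule wronskian_zero_imp_degree_eq)
  then have "lead_coeff d = 0"
    by (simp add: d_def pq)
  then show False
    using \<open>d \<noteq> 0\<close> by simp
qed

lemma poly_eq_if_eq_off_zero:
  fixes p q :: "real poly"
  assumes "\<And>t. t \<noteq> 0 \<Longrightarrow> t * poly p t = t * poly q t"
  shows "p = q"
proof -
  have "poly ([:0, 1:] * p) = poly ([:0, 1:] * q)"
  proof
    fix t show "poly ([:0, 1:] * p) t = poly ([:0, 1:] * q) t"
      using assms[of t] by (cases "t = 0") simp_all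
  qed
  then have "[:0, 1:] * p = [:0, 1:] * q"
    by (simp only: poly_eq_poly_eq_iff)
  then show ?thesis by simp
qed

section \<open>The characteristic polynomial of a Hermitian matrix\<close>

text \<open>
  Adding \<open>t\<close> to the diagonal changes the cycle product of a fixed point by \<open>t\<close> and no other one.
\<close>

definition moore_poly_term :: "'n::{finite,linorder} qmat \<Rightarrow> ('n \<Rightarrow> 'n) \<Rightarrow> 'n \<Rightarrow> real poly" where
  "moore_poly_term B \<sigma> m =
    (if \<sigma> m = m then [:qre (B $ m $ m), 1:] else [:qre (cycle_prod B \<sigma> m):])"

text \<open>
  The polynomial \<open>det (B + t)\<close> in \<open>t\<close>.
\<close>

definition moore_poly :: "'n::{finite,linorder} qmat \<Rightarrow> real poly" where
  "moore_poly B = (\<Sum>\<sigma> | \<sigma> permutes UNIV.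
    smult (rsign \<sigma>) (\<Prod>m\<in>cycle_starts \<sigma>. moore_poly_term B \<sigma> m))"

lemma poly_moore_poly_term:
  fixes B :: "'n::{finite,linorder} qmat"
  assumes \<sigma>: "\<sigma> permutes UNIV"
  shows "poly (moore_poly_term B \<sigma> m) t = qre (cycle_prod (B + t *\<^sub>R mat 1) \<sigma> m)"
proof (cases "\<sigma> m = m")
  case True
  then have "is_cycle \<sigma> (m # [])" by (simp add: is_cycle_def)
  from cycle_prod_is_cycle[OF this] show ?thesis
    using True by (simp add: moore_poly_term_def mat_def)
next
  case False
  have "cycle_prod (B + t *\<^sub>R mat 1) \<sigma> m = cycle_prod B \<sigma> m"
  proof (rule cycle_cong(3)[OF \<sigma> refl])
    fix y assume y: "y \<in> orbit \<sigma> m"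
    have "\<sigma> y \<noteq> y"
    proof
      assume "\<sigma> y = y"
      then have "orbit \<sigma> y = {y}" by (simp add: orbit_eq_singleton_iff)
      then have "m = y" using y in_orbit_commute[OF \<sigma>, of m y] by simp
      then show False using False \<open>\<sigma> y = y\<close> by simp
    qed
    then show "(B + t *\<^sub>R mat 1) $ y $ \<sigma> y = B $ y $ \<sigma> y"
      by (simp add: mat_def)
  qed
  then show ?thesis using False by (simp add: moore_poly_term_def)
qed

lemma poly_moore_poly: "poly (moore_poly B) t = moore_det (B + t *\<^sub>R mat 1)"
  by (simp add: moore_poly_def moore_det_def poly_sum poly_prod poly_moore_poly_term)

lemma moore_det_eq_poly_0: "moore_det B = poly (moore_poly B) 0"
  by (simp add: poly_moore_poly)

lemma fixed_point_cycle:
  assumes "\<sigma> x = x"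
  shows "x \<in> cycle_starts \<sigma>" "orbit \<sigma> x = {x}"
  using orbit_eq_singleton_iff[of \<sigma> x] assms by (simp_all add: cycle_starts_def)

text \<open>
  The diagonal cofactor collects the permutations that fix \<open>x\<close>, that is, it is the Moore
  determinant of \<open>B\<close> without row and column \<open>x\<close>.
\<close>

lemma qre_right_cofactor_diag:
  fixes B :: "'n::{finite,linorder} qmat"
  assumes B: "hermitian B"
  shows "qre (right_cofactor B x x) = (\<Sum>\<sigma> | \<sigma> permutes UNIV.
    if \<sigma> x = x then rsign \<sigma> * (\<Prod>m\<in>cycle_starts \<sigma> - {x}. qre (cycle_prod B \<sigma> m)) else 0)"
proof -
  let ?P = "{\<sigma> :: 'n \<Rightarrow> 'n. \<sigma> permutes UNIV}"
  \<comment> \<open>The indicator of the fixed point serves as the weight of the first cycle.\<close>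
  define h :: "('n \<Rightarrow> 'n) \<Rightarrow> quat" where "h \<sigma> = (if \<sigma> x = x then 1 else 0)" for \<sigma>
  have "right_cofactor B x x = (\<Sum>\<sigma>\<in>?P. if \<sigma> x = x then
      cycle_sign \<sigma> * prod_list (tl (row_factors x \<sigma> B)) else 0)"
    unfolding right_cofactor_def by (subst sum.inter_filter[symmetric]) simp_all
  also have "\<dots> = (\<Sum>\<sigma>\<in>?P. cycle_sign \<sigma> * h \<sigma> *
      prod_list (map (cycle_prod B \<sigma>) (other_cycle_starts x \<sigma>)))"
  proof (rule sum.cong[OF refl])
    fix \<sigma> :: "'n \<Rightarrow> 'n"
    show "(if \<sigma> x = x then cycle_sign \<sigma> * prod_list (tl (row_factors x \<sigma> B)) else 0) =
        cycle_sign \<sigma> * h \<sigma> * prod_list (map (cycle_prod B \<sigma>) (other_cycle_starts x \<sigma>))"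
    proof (cases "\<sigma> x = x")
      case True
      then have "is_cycle \<sigma> (x # [])" by (simp add: is_cycle_def)
      from cycle_factors_is_cycle[OF this] True show ?thesis
        by (simp add: h_def row_factors_def prod_list_concat cycle_prod_def[abs_def] comp_def)
    qed (simp add: h_def)
  qed
  also have "\<dots> = (\<Sum>\<sigma>\<in>?P. cycle_sign \<sigma> * h \<sigma> *
        of_real (\<Prod>m\<in>set (other_cycle_starts x \<sigma>). qre (cycle_prod B \<sigma> m)))"
  proof (rule sum_other_cycles_qre)
    fix \<sigma> :: "'n \<Rightarrow> 'n" and y assume "\<sigma> permutes UNIV" "y \<notin> orbit \<sigma> x"
    then have "x \<notin> orbit \<sigma> y" using in_orbit_commute[of \<sigma> x y] by simp
    then show "h (rev_cycle y \<sigma>) = h \<sigma>" by (simp add: h_def rev_cycle_def)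
  qed (rule hermitian_entry[OF B])
  also have "\<dots> = of_real (\<Sum>\<sigma>\<in>?P. if \<sigma> x = x then
      rsign \<sigma> * (\<Prod>m\<in>cycle_starts \<sigma> - {x}. qre (cycle_prod B \<sigma> m)) else 0)"
    unfolding of_real_sum
    by (rule sum.cong)
      (simp_all add: h_def cycle_sign_conv set_other_cycle_starts_conv fixed_point_cycle)
  finally show ?thesis by (simp del: of_real_sum)
qed

lemma pderiv_sum: "pderiv (sum f S) = (\<Sum>x\<in>S. pderiv (f x))"
  by (induction S rule: infinite_finite_induct) (simp_all add: pderiv_add)

text \<open>
  Differentiating the product over the cycles removes one fixed point \<open>x\<close> at a time, which
  leaves the diagonal cofactor at \<open>x\<close>.
\<close>

lemma poly_pderiv_moore_poly:
  fixes B :: "'n::{finite,linorder} qmat"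
  assumes B: "hermitian B"
  shows "poly (pderiv (moore_poly B)) t = re_trace (right_adj (B + t *\<^sub>R mat 1))"
proof -
  let ?P = "{\<sigma> :: 'n \<Rightarrow> 'n. \<sigma> permutes UNIV}" and ?B = "B + t *\<^sub>R mat 1"
  have "poly (pderiv (\<Prod>m\<in>cycle_starts \<sigma>. moore_poly_term B \<sigma> m)) t =
      (\<Sum>x\<in>UNIV. if \<sigma> x = x then \<Prod>m\<in>cycle_starts \<sigma> - {x}. qre (cycle_prod ?B \<sigma> m) else 0)"
    if "\<sigma> \<in> ?P" for \<sigma>
  proof -
    have \<sigma>: "\<sigma> permutes UNIV" using that by simp
    have "pderiv (moore_poly_term B \<sigma> x) = (if \<sigma> x = x then 1 else 0)" for x
      by (simp add: moore_poly_term_def pderiv_pCons)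
    then have "poly (pderiv (\<Prod>m\<in>cycle_starts \<sigma>. moore_poly_term B \<sigma> m)) t =
      (\<Sum>x\<in>cycle_starts \<sigma>. if \<sigma> x = x then \<Prod>m\<in>cycle_starts \<sigma> - {x}. qre (cycle_prod ?B \<sigma> m) else 0)"
      unfolding pderiv_prod poly_sum
      by (intro sum.cong refl) (simp add: poly_prod poly_moore_poly_term[OF \<sigma>])
    also have "\<dots> = (\<Sum>x\<in>UNIV. if \<sigma> x = x then \<Prod>m\<in>cycle_starts \<sigma> - {x}. qre (cycle_prod ?B \<sigma> m) else 0)"
      by (rule sum.mono_neutral_left) (use fixed_point_cycle(1) in auto)
    finally show ?thesis .
  qed
  then have "poly (pderiv (moore_poly B)) t = (\<Sum>\<sigma>\<in>?P. \<Sum>x\<in>UNIV.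
      if \<sigma> x = x then rsign \<sigma> * (\<Prod>m\<in>cycle_starts \<sigma> - {x}. qre (cycle_prod ?B \<sigma> m)) else 0)"
    unfolding moore_poly_def pderiv_sum poly_sum pderiv_smult poly_smult
    by (intro sum.cong refl) (auto simp: sum_distrib_left intro!: sum.cong)
  also have "\<dots> = re_trace (right_adj ?B)"
    unfolding re_trace_def right_adj_def vec_lambda_beta
      qre_right_cofactor_diag[OF hermitian_simps(3)[OF B]]
    by (rule sum.swap)
  finally show ?thesis .
qed

lemma degree_moore_poly_term: "degree (moore_poly_term B \<sigma> m) = (if \<sigma> m = m then 1 else 0)"
  by (simp add: moore_poly_term_def)

text \<open>
  The degree of the contribution of a permutation is at most its number of fixed points, so the
  identity alone contributes in degree \<open>n\<close>, the size of the matrix.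
\<close>

lemma
  fixes B :: "'n::{finite,linorder} qmat"
  shows degree_moore_poly: "degree (moore_poly B) = CARD('n)"
    and lead_coeff_moore_poly: "lead_coeff (moore_poly B) = 1"
proof -
  let ?P = "{\<sigma> :: 'n \<Rightarrow> 'n. \<sigma> permutes UNIV}"
  define T where "T \<sigma> = smult (rsign \<sigma>) (\<Prod>m\<in>cycle_starts \<sigma>. moore_poly_term B \<sigma> m)" for \<sigma>
  have orbit_id: "orbit id x = {x}" for x :: 'n
    by (simp add: orbit_eq_singleton_iff)
  have "range (orbit (id :: 'n \<Rightarrow> 'n)) = (\<lambda>x. {x}) ` UNIV"
    by (simp add: orbit_id)
  then have "rsign (id :: 'n \<Rightarrow> 'n) = 1"
    by (simp add: rsign_def card_image)
  moreover have "cycle_starts id = (UNIV :: 'n set)"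
    by (simp add: cycle_starts_def orbit_id)
  ultimately have id: "T id = (\<Prod>m\<in>UNIV. [:qre (B $ m $ m), 1:])"
    by (simp add: T_def moore_poly_term_def)
  have deg_id: "degree (T id) = CARD('n)"
    unfolding id by (subst degree_prod_eq_sum_degree) simp_all
  have lc_id: "lead_coeff (T id) = 1"
    unfolding id by (simp add: lead_coeff_prod)
  have deg: "degree (T \<sigma>) < CARD('n)" if "\<sigma> \<in> ?P - {id}" for \<sigma>
  proof -
    have "\<sigma> \<noteq> id"
      using that by simp
    then obtain x where x: "\<sigma> x \<noteq> x"
      by (auto simp: fun_eq_iff)
    have "degree (T \<sigma>) \<le> (\<Sum>m\<in>cycle_starts \<sigma>. degree (moore_poly_term B \<sigma> m))"
      unfolding T_def using degree_smult_le degree_prod_sum_le[of "cycle_starts \<sigma>" "moore_poly_term B \<sigma>"]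
      by (metis (no_types, lifting) comp_apply finite order_trans sum.cong)
    also have "\<dots> \<le> (\<Sum>m\<in>UNIV. degree (moore_poly_term B \<sigma> m))"
      by (rule sum_mono2) simp_all
    also have "\<dots> = card {m. \<sigma> m = m}"
      by (simp add: degree_moore_poly_term sum.If_cases)
    also have "\<dots> < CARD('n)"
      using x by (intro psubset_card_mono) auto
    finally show ?thesis .
  qed
  have split: "moore_poly B = T id + sum T (?P - {id})"
    unfolding moore_poly_def T_def[symmetric] by (rule sum.remove) (simp_all add: permutes_id)
  have rest: "degree (sum T (?P - {id})) < CARD('n)"
    by (rule degree_sum_less) (use deg in auto)
  show d: "degree (moore_poly B) = CARD('n)"
    unfolding split using rest deg_id by (simp add: degree_add_eq_left)
  show "lead_coeff (moore_poly B) = 1"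
    unfolding d unfolding split using rest lc_id deg_id by (simp add: coeff_eq_0)
qed

lemma moore_poly_nonzero: "moore_poly B \<noteq> 0"
  using lead_coeff_moore_poly[of B] by auto

text \<open>
  Put \<open>M = A\<^sup>* A + t\<close> and \<open>N = A A\<^sup>* + t\<close>, with determinants \<open>p, q\<close> and adjugates \<open>Y, X\<close>. From
  \<open>M A\<^sup>* = A\<^sup>* N\<close> one gets \<open>q Y A\<^sup>* = p A\<^sup>* X\<close>. Multiplying by \<open>A\<close> and taking real traces, while
  \<open>Y M = p\<close> and \<open>N X = q\<close> express \<open>tr (Y A\<^sup>* A)\<close> and \<open>tr (A A\<^sup>* X)\<close> by \<open>n p - t p'\<close> and
  \<open>n q - t q'\<close>, yields \<open>t p' q = t p q'\<close>.
\<close>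

lemma moore_poly_ctransp_mult_commute: "moore_poly (ctransp A ** A) = moore_poly (A ** ctransp A)"
proof -
  let ?p = "moore_poly (ctransp A ** A)" and ?q = "moore_poly (A ** ctransp A)"
  have "pderiv ?p * ?q = ?p * pderiv ?q"
  proof (rule poly_eq_if_eq_off_zero)
    fix t :: real
    define M where "M = ctransp A ** A + t *\<^sub>R mat 1"
    define N where "N = A ** ctransp A + t *\<^sub>R mat 1"
    define Y where "Y = left_adj M"
    define X where "X = right_adj N"
    define p where "p = poly ?p t"
    define q where "q = poly ?q t"
    have YM: "Y ** M = p *\<^sub>R mat 1" and NX: "N ** X = q *\<^sub>R mat 1"
      unfolding Y_def X_def p_def q_def poly_moore_poly M_def[symmetric] N_def[symmetric]
      by (simp_all add: left_adj_mult mult_right_adj hermitian_simps M_def N_def)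
    have p': "poly (pderiv ?p) t = re_trace Y"
      by (simp add: poly_pderiv_moore_poly hermitian_simps Y_def M_def left_adj_def re_trace_simps)
    have q': "poly (pderiv ?q) t = re_trace X"
      by (simp add: poly_pderiv_moore_poly hermitian_simps X_def N_def)
    have comm: "M ** ctransp A = ctransp A ** N"
      by (simp add: M_def N_def matrix_add_ldistrib matrix_add_rdistrib matrix_mul_assoc
          scaleR_matrix_mult)
    have "q *\<^sub>R (Y ** ctransp A) = Y ** ctransp A ** (N ** X)"
      by (simp add: NX scaleR_matrix_mult)
    also have "\<dots> = (Y ** M) ** ctransp A ** X"
      by (metis comm matrix_mul_assoc)
    also have "\<dots> = p *\<^sub>R (ctransp A ** X)"
      by (simp add: YM scaleR_matrix_mult)
    finally have key: "q *\<^sub>R (Y ** ctransp A) = p *\<^sub>R (ctransp A ** X)" .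
    have "q * re_trace (Y ** (ctransp A ** A)) = re_trace (q *\<^sub>R (Y ** ctransp A) ** A)"
      by (simp add: re_trace_simps scaleR_matrix_mult matrix_mul_assoc)
    also have "\<dots> = p * re_trace (ctransp A ** X ** A)"
      unfolding key by (simp add: re_trace_simps scaleR_matrix_mult)
    also have "re_trace (ctransp A ** X ** A) = re_trace ((A ** ctransp A) ** X)"
      by (subst re_trace_mult_commute) (simp add: matrix_mul_assoc)
    finally have tr: "q * re_trace (Y ** (ctransp A ** A)) = p * re_trace ((A ** ctransp A) ** X)" .
    have "re_trace (Y ** (ctransp A ** A)) + t * re_trace Y = real CARD('a) * p"
      using arg_cong[OF YM, of re_trace]
      by (simp add: M_def matrix_add_ldistrib scaleR_matrix_mult re_trace_simps)
    moreover have "re_trace ((A ** ctransp A) ** X) + t * re_trace X = real CARD('a) * q"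
      using arg_cong[OF NX, of re_trace]
      by (simp add: N_def matrix_add_rdistrib scaleR_matrix_mult re_trace_simps)
    ultimately have "t * (re_trace Y * q) = t * (p * re_trace X)"
      using tr by algebra
    then show "t * poly (pderiv ?p * ?q) t = t * poly (?p * pderiv ?q) t"
      by (simp add: p' q' p_def q_def)
  qed
  from wronskian_zero_imp_proportional[OF moore_poly_nonzero moore_poly_nonzero this]
  show ?thesis by (simp add: lead_coeff_moore_poly)
qed

text \<open>
  Let \<open>p(t) = det (B + t)\<close> and \<open>r(s) = det (D + s)\<close> for the inverse \<open>D\<close> of \<open>B\<close>. For \<open>s = 1 / t\<close>
  we have \<open>B + t = t B (D + s)\<close>, so the adjugates \<open>Y\<close> of \<open>B + t\<close> and \<open>Z\<close> of \<open>D + s\<close> satisfy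
  \<open>p Z = t r Y B\<close>. Taking real traces relates \<open>r'\<close> to \<open>p'\<close> and shows that \<open>p\<close> is proportional to
  \<open>q(t) = t\<^sup>n r(1 / t)\<close>, the reflected polynomial of \<open>r\<close>. As \<open>q(0)\<close> is the leading coefficient
  of \<open>r\<close>, it is 1, and so \<open>p(0) = det B\<close> is not zero.
\<close>

lemma moore_det_nonzero:
  fixes B :: "'n::{finite,linorder} qmat"
  assumes B: "hermitian B" and D: "B ** D = mat 1" "D ** B = mat 1"
  shows "moore_det B \<noteq> 0"
proof -
  have "ctransp D ** B = mat 1"
    using arg_cong[OF D(1), of ctransp] B by (simp add: ctransp_mult hermitian_def)
  then have "ctransp D = D"
    using D(1) by (rule left_inverse_eq_right_inverse)
  then have hD: "hermitian D" by (simp add: hermitian_def)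
  let ?p = "moore_poly B" and ?r = "moore_poly D"
  let ?n = "CARD('n)"
  let ?q = "reflect_poly ?r"
  have "pderiv ?p * ?q = ?p * pderiv ?q"
  proof (rule poly_eq_if_eq_off_zero)
    fix t :: real assume t: "t \<noteq> 0"
    define M where "M = B + t *\<^sub>R mat 1"
    define N where "N = D + inverse t *\<^sub>R mat 1"
    define Y where "Y = left_adj M"
    define Z where "Z = right_adj N"
    define p where "p = poly ?p t"
    define p' where "p' = poly (pderiv ?p) t"
    define r where "r = poly ?r (inverse t)"
    define r' where "r' = poly (pderiv ?r) (inverse t)"
    define q where "q = poly ?q t"
    define q' where "q' = poly (pderiv ?q) t"
    have YM: "Y ** M = p *\<^sub>R mat 1" and NZ: "N ** Z = r *\<^sub>R mat 1"
      unfolding Y_def Z_def p_def r_def poly_moore_poly M_def[symmetric] N_def[symmetric]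
      using B hD by (simp_all add: left_adj_mult mult_right_adj hermitian_simps M_def N_def)
    have p': "p' = re_trace Y"
      using B by (simp add: p'_def poly_pderiv_moore_poly Y_def M_def left_adj_def re_trace_simps)
    have r': "r' = re_trace Z"
      using hD by (simp add: r'_def poly_pderiv_moore_poly Z_def N_def)
    have M: "M = t *\<^sub>R (B ** N)"
      using t by (simp add: M_def N_def D matrix_add_ldistrib scaleR_matrix_mult scaleR_add_right add.commute)
    have "p *\<^sub>R Z = Y ** M ** Z"
      by (simp add: YM scaleR_matrix_mult)
    also have "\<dots> = t *\<^sub>R (Y ** B ** (N ** Z))"
      by (simp add: M scaleR_matrix_mult matrix_mul_assoc)
    also have "\<dots> = (t * r) *\<^sub>R (Y ** B)"
      by (simp add: NZ scaleR_matrix_mult)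
    finally have "p * r' = t * r * re_trace (Y ** B)"
      unfolding r' by (metis re_trace_simps(2))
    moreover have "re_trace (Y ** B) + t * p' = real ?n * p"
      using arg_cong[OF YM, of re_trace]
      by (simp add: p' M_def matrix_add_ldistrib scaleR_matrix_mult re_trace_simps)
    ultimately have 1: "p * r' = t * r * (real ?n * p - t * p')"
      by (metis add_diff_cancel_right')
    obtain k where k: "?n = Suc k"
      using not0_implies_Suc[of ?n] by auto
    have q: "q = t ^ ?n * r"
      using t by (simp add: q_def r_def poly_reflect_poly_nz degree_moore_poly)
    have pw: "real k * t ^ (k - Suc 0) * t = real k * t ^ k"
      by (cases k) simp_all
    \<comment> \<open>Away from 0 the reflected polynomial is \<open>x\<^sup>n r(1 / x)\<close>, which gives a second expression for \<open>q'\<close>.\<close>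
    have "(poly ?q has_real_derivative q') (at t)"
      unfolding q'_def by (rule poly_DERIV)
    moreover have "(poly ?q has_real_derivative
        real ?n * t ^ k * r - t ^ ?n * (r' * inverse (t ^ 2))) (at t)"
    proof (rule has_field_derivative_transform_within_open)
      show "((\<lambda>x. x ^ ?n * poly ?r (inverse x)) has_real_derivative
          real ?n * t ^ k * r - t ^ ?n * (r' * inverse (t ^ 2))) (at t)"
        using t
        by (auto intro!: derivative_eq_intros DERIV_chain2[OF poly_DERIV] simp: r_def r'_def k
            power2_eq_square distrib_right pw)
      show "open (- {0 :: real})"
        by (rule open_Compl) simp
    qed (use t in \<open>auto simp: poly_reflect_poly_nz degree_moore_poly\<close>)
    ultimately have "q' = real ?n * t ^ k * r - t ^ ?n * (r' * inverse (t ^ 2))"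
      by (rule DERIV_unique)
    then have "t * q' = real ?n * q - t ^ k * r'"
      using t unfolding q k by (simp add: field_simps power2_eq_square)
    moreover have "t * (p * q') = p * (t * q')"
      by simp
    ultimately have "t * (p * q') = p * (real ?n * q) - t ^ k * (p * r')"
      by (simp only: right_diff_distrib mult.left_commute)
    also have "\<dots> = t * (p' * q)"
      unfolding 1 q k by (simp add: algebra_simps)
    finally show "t * poly (pderiv ?p * ?q) t = t * poly (?p * pderiv ?q) t"
      by (auto simp: p_def p'_def q_def q'_def)
  qed
  from wronskian_zero_imp_proportional[OF moore_poly_nonzero _ this]
  have "smult (lead_coeff ?q) ?p = ?q"
    by (simp add: moore_poly_nonzero lead_coeff_moore_poly)
  then have "lead_coeff ?q * poly ?p 0 = poly ?q 0"
    by (metis poly_smult)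
  then show ?thesis
    by (auto simp: moore_det_eq_poly_0 lead_coeff_moore_poly)
qed

section \<open>The double determinant and the double cofactors\<close>

lemma cdet_hermitian:
  assumes "hermitian B"
  shows "cdet j B = of_real (moore_det B)"
  using assms rdet_hermitian[OF assms] by (simp add: cdet_conv_rdet hermitian_def)

lemma hdet_hermitian:
  fixes B :: "'n::{finite,linorder} qmat"
  assumes "hermitian B"
  shows "hdet B = moore_det B"
  unfolding hdet_def by (simp add: rdet_hermitian[OF assms] cdet_hermitian[OF assms])

lemma ddet_conv: "ddet A = moore_det (ctransp A ** A)" "ddet A = moore_det (A ** ctransp A)"
  by (simp_all add: ddet_def hdet_hermitian hermitian_simps moore_det_eq_poly_0
      moore_poly_ctransp_mult_commute)

text \<open>
  If \<open>ddet A \<noteq> 0\<close>, then \<open>A\<^sup>* A\<close> provides a left inverse of \<open>A\<close>, and \<open>A A\<^sup>*\<close>, which has the same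
  determinant, provides a right one. Conversely, an inverse \<open>C\<close> of \<open>A\<close> yields the inverse
  \<open>C C\<^sup>*\<close> of \<open>A\<^sup>* A\<close>.
\<close>

lemma invertible_iff_ddet_nonzero: "invertible A \<longleftrightarrow> ddet A \<noteq> 0"
proof
  assume "invertible A"
  then obtain C where C: "A ** C = mat 1" "C ** A = mat 1"
    by (auto simp: invertible_def)
  have CT: "ctransp A ** ctransp C = mat 1" "ctransp C ** ctransp A = mat 1"
    unfolding ctransp_mult[symmetric] by (simp_all add: C)
  have "ctransp A ** A ** (C ** ctransp C) = ctransp A ** (A ** C) ** ctransp C"
    by (simp only: matrix_mul_assoc)
  also have "\<dots> = mat 1"
    by (simp add: C CT)
  finally have 1: "ctransp A ** A ** (C ** ctransp C) = mat 1" .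
  have "C ** ctransp C ** (ctransp A ** A) = C ** (ctransp C ** ctransp A) ** A"
    by (simp only: matrix_mul_assoc)
  also have "\<dots> = mat 1"
    by (simp add: C CT)
  finally have 2: "C ** ctransp C ** (ctransp A ** A) = mat 1" .
  show "ddet A \<noteq> 0"
    unfolding ddet_conv by (rule moore_det_nonzero[OF hermitian_simps(1) 1 2])
next
  assume d: "ddet A \<noteq> 0"
  have L: "(matrix_inv (ctransp A ** A) ** ctransp A) ** A = mat 1"
    using matrix_inv_hermitian(4)[OF hermitian_simps(1), of A] d
    by (simp add: ddet_conv(1) matrix_mul_assoc)
  have R: "A ** (ctransp A ** matrix_inv (A ** ctransp A)) = mat 1"
    using matrix_inv_hermitian(5)[OF hermitian_simps(2), of A] d
    by (simp add: ddet_conv(2) matrix_mul_assoc)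
  show "invertible A"
    unfolding invertible_def using L R left_inverse_eq_right_inverse[OF L R] by metis
qed

lemma right_double_cofactor_conv_rdet:
  "right_double_cofactor A i j = rdet i (replace_row i (row j (ctransp A)) (A ** ctransp A))"
  by (simp add: right_double_cofactor_def rdet_replace_row row_def)

text \<open>
  This duality reduces all statements on left double cofactors to the right ones of \<open>A\<^sup>*\<close>.
\<close>

lemma left_double_cofactor_conv_right:
  "left_double_cofactor A i j = qcnj (right_double_cofactor (ctransp A) j i)"
  by (simp add: left_double_cofactor_def right_double_cofactor_def qcnj_sum
      left_cofactor_conv_right_cofactor ctransp_mult) (simp add: ctransp_def)

lemma left_double_cofactor_conv_cdet:
  "left_double_cofactor A i j = cdet j (replace_col j (column i (ctransp A)) (ctransp A ** A))"
proof -
  have "ctransp (replace_col j v B) = replace_row j (\<chi> q. qcnj (v $ q)) (ctransp B)" for v B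
    by (simp add: ctransp_def replace_col_def replace_row_def vec_eq_iff)
  moreover have "(\<chi> q. qcnj (column i (ctransp A) $ q)) = row i A"
    by (simp add: column_def row_def ctransp_def vec_eq_iff)
  ultimately show ?thesis
    by (simp add: cdet_conv_rdet left_double_cofactor_conv_right right_double_cofactor_conv_rdet
        ctransp_mult)
qed

lemma rdet_expand_double_cofactors:
  "rdet i (A ** ctransp A) = (\<Sum>j\<in>UNIV. A $ i $ j * right_double_cofactor A i j)"
proof -
  have "rdet i (A ** ctransp A) =
      (\<Sum>q\<in>UNIV. \<Sum>j\<in>UNIV. A $ i $ j * ctransp A $ j $ q * right_cofactor (A ** ctransp A) i q)"
    unfolding rdet_expand_row
    by (simp add: matrix_matrix_mult_def[of A "ctransp A"] sum_distrib_right)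
  also have "\<dots> = (\<Sum>j\<in>UNIV. A $ i $ j * right_double_cofactor A i j)"
    unfolding right_double_cofactor_def sum_distrib_left mult.assoc by (rule sum.swap)
  finally show ?thesis .
qed

lemma cdet_expand_double_cofactors:
  "cdet j (ctransp A ** A) = (\<Sum>i\<in>UNIV. left_double_cofactor A i j * A $ i $ j)"
  using rdet_expand_double_cofactors[of j "ctransp A"]
  by (simp add: cdet_conv_rdet ctransp_mult left_double_cofactor_conv_right qcnj_sum)
    (simp add: ctransp_def)

lemma left_adj_mult_ctransp:
  "left_adj (ctransp A ** A) ** ctransp A = (\<chi> i j. left_double_cofactor A j i)"
  by (simp add: vec_eq_iff matrix_mult_entry left_double_cofactor_def
      left_cofactor_conv_right_cofactor left_adj_def right_adj_def ctransp_mult ctransp_entry)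

lemma ctransp_mult_right_adj:
  "ctransp A ** right_adj (A ** ctransp A) = (\<chi> i j. right_double_cofactor A j i)"
  by (simp add: vec_eq_iff matrix_mult_entry right_double_cofactor_def right_adj_def)

theorem theorem8p1:
  fixes A :: "'n::{finite,linorder} qmat"
  shows "(invertible A \<longleftrightarrow> ddet A \<noteq> 0) \<and>
    (invertible A \<longrightarrow>
       invertible (ctransp A ** A) \<and> invertible (A ** ctransp A) \<and>
       matrix_inv A = matrix_inv (ctransp A ** A) ** ctransp A \<and>
       matrix_inv (ctransp A ** A) ** ctransp A =
         (1 / ddet A) *\<^sub>R (\<chi> i j. left_double_cofactor A j i) \<and>
       matrix_inv A = ctransp A ** matrix_inv (A ** ctransp A) \<and>
       ctransp A ** matrix_inv (A ** ctransp A) =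
         (1 / ddet (ctransp A)) *\<^sub>R (\<chi> i j. right_double_cofactor A j i)) \<and>
    (\<forall>i j. left_double_cofactor A i j =
       cdet j (replace_col j (column i (ctransp A)) (ctransp A ** A))) \<and>
    (\<forall>i j. right_double_cofactor A i j =
       rdet i (replace_row i (row j (ctransp A)) (A ** ctransp A))) \<and>
    (\<forall>j. of_real (ddet A) = cdet j (ctransp A ** A) \<and>
       cdet j (ctransp A ** A) = (\<Sum>i\<in>UNIV. left_double_cofactor A i j * A $ i $ j)) \<and>
    (\<forall>i. of_real (ddet A) = rdet i (A ** ctransp A) \<and>
       rdet i (A ** ctransp A) = (\<Sum>j\<in>UNIV. A $ i $ j * right_double_cofactor A i j))"
proof (intro conjI impI allI)
  show "invertible A \<longleftrightarrow> ddet A \<noteq> 0"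
    by (rule invertible_iff_ddet_nonzero)
next
  assume "invertible A"
  then have d: "ddet A \<noteq> 0"
    by (simp add: invertible_iff_ddet_nonzero)
  note L = matrix_inv_hermitian[OF hermitian_simps(1), of A, folded ddet_conv(1), OF d]
  note R = matrix_inv_hermitian[OF hermitian_simps(2), of A, folded ddet_conv(2), OF d]
  have 1: "matrix_inv (ctransp A ** A) ** ctransp A ** A = mat 1"
    using L(4) by (simp add: matrix_mul_assoc)
  have 2: "A ** (ctransp A ** matrix_inv (A ** ctransp A)) = mat 1"
    using R(5) by (simp add: matrix_mul_assoc)
  note eq = left_inverse_eq_right_inverse[OF 1 2]
  show "invertible (ctransp A ** A)" "invertible (A ** ctransp A)"
    by (fact L(1), fact R(1))
  show inv: "matrix_inv A = matrix_inv (ctransp A ** A) ** ctransp A"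
    by (rule matrix_inv_eqI) (use 1 2 eq in simp_all)
  show "matrix_inv A = ctransp A ** matrix_inv (A ** ctransp A)"
    using inv eq by simp
  show "matrix_inv (ctransp A ** A) ** ctransp A =
      (1 / ddet A) *\<^sub>R (\<chi> i j. left_double_cofactor A j i)"
    by (simp add: L(2) scaleR_matrix_mult left_adj_mult_ctransp)
  have "ddet (ctransp A) = ddet A"
    by (simp add: ddet_conv(1)[of "ctransp A"] ddet_conv(2)[of A])
  then show "ctransp A ** matrix_inv (A ** ctransp A) =
      (1 / ddet (ctransp A)) *\<^sub>R (\<chi> i j. right_double_cofactor A j i)"
    by (simp add: R(3) scaleR_matrix_mult ctransp_mult_right_adj)
next
  fix i j
  show "left_double_cofactor A i j =
      cdet j (replace_col j (column i (ctransp A)) (ctransp A ** A))"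
    by (rule left_double_cofactor_conv_cdet)
  show "right_double_cofactor A i j =
      rdet i (replace_row i (row j (ctransp A)) (A ** ctransp A))"
    by (rule right_double_cofactor_conv_rdet)
  show "of_real (ddet A) = cdet j (ctransp A ** A)"
    by (simp add: ddet_conv(1) cdet_hermitian hermitian_simps)
  show "cdet j (ctransp A ** A) = (\<Sum>i\<in>UNIV. left_double_cofactor A i j * A $ i $ j)"
    by (rule cdet_expand_double_cofactors)
  show "of_real (ddet A) = rdet i (A ** ctransp A)"
    by (simp add: ddet_conv(2) rdet_hermitian hermitian_simps)
  show "rdet i (A ** ctransp A) = (\<Sum>j\<in>UNIV. A $ i $ j * right_double_cofactor A i j)"
    by (rule rdet_expand_double_cofactors)
qed

end
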